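(* Let $X$ be a Banach space with the Daugavet property, let $T\in\operatorname{Lip}(X)$, and suppose that $\overline{\operatorname{conv}}(\operatorname{slope}(T))$ has one of the following properties: the Radon-Nikodým property, the Asplund property, CPCP, or absence of $\ell_1$-sequences. Then $T$ satisfies the Daugavet equation $\|\mathrm{Id}+T\|=1+\|T\|$.
   Context: $X$ is a real or complex Banach space. $X$ has the Daugavet property if every rank-one bounded linear operator $R:X\to X$ satisfies $\|\mathrm{Id}+R\|=1+\|R\|$. $\operatorname{Lip}(X)$ is the space of Lipschitz maps $T:X\to X$ (not necessarily linear) with the seminorm $\|T\|=\sup\left\{\frac{\|T(x_1)-T(x_2)\|}{\|x_1-x_2\|}:x_1\neq x_2\in X\right\}$ (formally modulo constants, or with $T(0)=0$). $\operatorname{slope}(T):=\left\{\frac{T(x_1)-T(x_2)}{\|x_1-x_2\|}:x_1\neq x_2\in X\right\}$. Properties of a closed bounded convex set $C\subset X$ (standard meanings): $C$ has the Radon-Nikodým property if every non-empty closed convex subset of $C$ is dentable, i.e. has slices (non-empty intersections with open half-spaces) of arbitrarily small diameter. $C$ has the Asplund property if for every countable $B\subset C$ the seminormed space $(X^*,\rho_B)$, $\rho_B(x^* )=\sup_{b\in B}|x^*(b)|$, is separable. $C$ has CPCP (the convex point of continuity property) if every non-empty closed convex subset $D\subset C$ contains a point at which the identity map $(D,\text{weak})\to(D,\|\cdot\|)$ is continuous. Absence of $\ell_1$-sequences means that $C$ contains no sequence equivalent to the canonical basis of $\ell_1$. *)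

theory Defs
  imports "HOL-Analysis.Analysis"
begin

text \<open>
  Scalars: a Banach space over a field \<open>'k\<close> (below: \<open>real\<close> or \<open>complex\<close>) is a type \<open>'a::banach\<close>
  together with a scalar multiplication \<open>sc :: 'k \<Rightarrow> 'a \<Rightarrow> 'a\<close>; in the real case \<open>sc\<close> is
  \<^const>\<open>scaleR\<close>, in the complex case \<open>sc\<close> is required to satisfy the following predicate.
\<close>

definition complex_normed_structure :: "(complex \<Rightarrow> 'a::real_normed_vector \<Rightarrow> 'a) \<Rightarrow> bool" where
  "complex_normed_structure sc \<longleftrightarrow>
     vector_space sc \<and>
     (\<forall>c x. norm (sc c x) = norm c * norm x) \<and>
     (\<forall>r x. sc (complex_of_real r) x = r *\<^sub>R x)"

definition dual_space ::
  "('k::real_normed_field \<Rightarrow> 'a::real_normed_vector \<Rightarrow> 'a) \<Rightarrow> ('a \<Rightarrow> 'k) set" where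
  "dual_space sc = {f. bounded_linear f \<and> (\<forall>c x. f (sc c x) = c * f x)}"

definition rank_one_operator ::
  "('k::real_normed_field \<Rightarrow> 'a::real_normed_vector \<Rightarrow> 'a) \<Rightarrow> ('a \<Rightarrow> 'a) \<Rightarrow> bool" where
  "rank_one_operator sc R \<longleftrightarrow>
     bounded_linear R \<and> (\<forall>c x. R (sc c x) = sc c (R x)) \<and>
     (\<exists>y. y \<noteq> 0 \<and> range R = range (\<lambda>c. sc c y))"

definition daugavet_property ::
  "('k::real_normed_field \<Rightarrow> 'a::real_normed_vector \<Rightarrow> 'a) \<Rightarrow> bool" where
  "daugavet_property sc \<longleftrightarrow>
     (\<forall>R. rank_one_operator sc R \<longrightarrow> onorm (\<lambda>x. x + R x) = 1 + onorm R)"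

text \<open>The Lipschitz seminorm; meaningful for Lipschitz maps on a nonzero space.\<close>

definition lip_norm :: "('a::real_normed_vector \<Rightarrow> 'a) \<Rightarrow> real" where
  "lip_norm T = Sup {norm (T x1 - T x2) / norm (x1 - x2) | x1 x2. x1 \<noteq> x2}"

definition slope :: "('a::real_normed_vector \<Rightarrow> 'a) \<Rightarrow> 'a set" where
  "slope T = {(T x1 - T x2) /\<^sub>R norm (x1 - x2) | x1 x2. x1 \<noteq> x2}"

text \<open>
  Open half-spaces are given by nonzero bounded real-linear functionals. On a complex space
  these are exactly the real parts of the nonzero complex functionals.
\<close>

definition is_slice :: "'a::real_normed_vector set \<Rightarrow> 'a set \<Rightarrow> bool" where
  "is_slice D S \<longleftrightarrow> S \<noteq> {} \<and>
     (\<exists>(f :: 'a \<Rightarrow> real) a. bounded_linear f \<and> (\<exists>x. f x \<noteq> 0) \<and> S = D \<inter> {x. a < f x})"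

text \<open>
  The following notions are meant for closed bounded convex sets; for unbounded sets the value
  of \<^const>\<open>diameter\<close> and the supremum in \<open>rho\<close> carry no information.
\<close>

definition dentable :: "'a::real_normed_vector set \<Rightarrow> bool" where
  "dentable D \<longleftrightarrow> (\<forall>e>0. \<exists>S. is_slice D S \<and> diameter S < e)"

definition radon_nikodym_property :: "'a::real_normed_vector set \<Rightarrow> bool" where
  "radon_nikodym_property C \<longleftrightarrow>
     (\<forall>D. D \<subseteq> C \<and> D \<noteq> {} \<and> closed D \<and> convex D \<longrightarrow> dentable D)"

text \<open>The case distinction makes the seminorm zero for empty \<open>B\<close>, where the real supremum is unspecified.\<close>

definition rho :: "'a set \<Rightarrow> ('a \<Rightarrow> 'k::real_normed_field) \<Rightarrow> real" where
  "rho B f = (if B = {} then 0 else (SUP b\<in>B. norm (f b)))"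

definition asplund_property ::
  "('k::real_normed_field \<Rightarrow> 'a::real_normed_vector \<Rightarrow> 'a) \<Rightarrow> 'a set \<Rightarrow> bool" where
  "asplund_property sc C \<longleftrightarrow>
     (\<forall>B. countable B \<and> B \<subseteq> C \<longrightarrow>
        (\<exists>Q. countable Q \<and> Q \<subseteq> dual_space sc \<and>
             (\<forall>f\<in>dual_space sc. \<forall>e>0. \<exists>q\<in>Q. rho B (\<lambda>x. f x - q x) < e)))"

definition weak_topology ::
  "('k::real_normed_field \<Rightarrow> 'a::real_normed_vector \<Rightarrow> 'a) \<Rightarrow> 'a topology" where
  "weak_topology sc = topology_generated_by {f -` U | f U. f \<in> dual_space sc \<and> open U}"

definition cpcp ::
  "('k::real_normed_field \<Rightarrow> 'a::real_normed_vector \<Rightarrow> 'a) \<Rightarrow> 'a set \<Rightarrow> bool" where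
  "cpcp sc C \<longleftrightarrow>
     (\<forall>D. D \<subseteq> C \<and> D \<noteq> {} \<and> closed D \<and> convex D \<longrightarrow>
        (\<exists>x\<in>D. topcontinuous_at (subtopology (weak_topology sc) D) (top_of_set D) (\<lambda>y. y) x))"

text \<open>Equivalence to the canonical basis of \<open>\<ell>\<^sub>1\<close> over the scalar field \<open>'k\<close>.\<close>

definition l1_sequence ::
  "('k::real_normed_field \<Rightarrow> 'a::real_normed_vector \<Rightarrow> 'a) \<Rightarrow> (nat \<Rightarrow> 'a) \<Rightarrow> bool" where
  "l1_sequence sc e \<longleftrightarrow>
     (\<exists>m M. 0 < m \<and>
        (\<forall>n (a :: nat \<Rightarrow> 'k).
           m * (\<Sum>i<n. norm (a i)) \<le> norm (\<Sum>i<n. sc (a i) (e i)) \<and>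
           norm (\<Sum>i<n. sc (a i) (e i)) \<le> M * (\<Sum>i<n. norm (a i))))"

definition no_l1_sequences ::
  "('k::real_normed_field \<Rightarrow> 'a::real_normed_vector \<Rightarrow> 'a) \<Rightarrow> 'a set \<Rightarrow> bool" where
  "no_l1_sequences sc C \<longleftrightarrow> \<not> (\<exists>e. (\<forall>n. e n \<in> C) \<and> l1_sequence sc e)"

end

theory Submission
  imports Defs
begin

text \<open>
  Suppose \<open>\<parallel>e + s\<parallel> \<le> 1 + \<parallel>T\<parallel> - \<epsilon>\<close> for every direction \<open>e\<close> with slope \<open>s\<close>, and fix \<open>y0\<close> in the closed
  convex hull \<open>C\<close> of the slopes, with norm close to \<open>\<parallel>T\<parallel>\<close>. By the Daugavet property, directions that are
  almost \<open>\<ell>\<^sub>1\<close>-orthogonal to a given finite set of vectors have the whole unit ball as closed convex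
  hull, so some of them have a slope in any prescribed half-space meeting \<open>C\<close>. If \<open>\<psi>\<close> has norm about
  \<open>1\<close> and \<open>\<psi> e \<ge> 1\<close>, then \<open>\<psi> s\<close> is at most about \<open>\<parallel>T\<parallel> - \<epsilon>\<close>; and by \<open>\<ell>\<^sub>1\<close>-orthogonality every functional in
  the ball is approximated by such a \<open>\<psi>\<close> on finitely many given vectors. Averaging slopes yields
  points \<open>t \<in> C\<close> that are weakly as close to \<open>y0\<close> as we like, although some \<open>\<psi>\<close> separates them from
  \<open>y0\<close> by a fixed amount.

  Hence no weak neighbourhood of such a \<open>y0\<close> in \<open>C\<close> is small in norm, which excludes the
  Radon--Nikodym property and CPCP. Iterating, each new \<open>t\<close> can be seen by the functionals chosen so
  far either as \<open>y0\<close> or as separated from it, and this independence makes the points an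
  \<open>\<ell>\<^sub>1\<close>-sequence in \<open>C\<close>. The Asplund property excludes \<open>\<ell>\<^sub>1\<close>-sequences as well, since the \<open>0/1\<close>-patterns on
  such a sequence extend to uncountably many uniformly separated functionals.
\<close>

section \<open>Hahn--Banach\<close>

definition sublinear :: "('a::real_vector \<Rightarrow> real) \<Rightarrow> bool" where
  "sublinear p \<longleftrightarrow> (\<forall>x y. p (x + y) \<le> p x + p y) \<and> (\<forall>t\<ge>0. \<forall>x. p (t *\<^sub>R x) = t * p x)"

text \<open>Applying \<open>scale\<close> to \<open>t *\<^sub>R x\<close> with the factor
  \<open>1 / t\<close> gives the converse inequality, so for functionals defined as infima one half
  of homogeneity has to be checked.\<close>

lemma sublinearI:
  fixes p :: "'a::real_vector \<Rightarrow> real"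
  assumes add: "\<And>x y. p (x + y) \<le> p x + p y" and zero: "p 0 = 0"
    and scale: "\<And>t x. t > 0 \<Longrightarrow> t * p x \<le> p (t *\<^sub>R x)"
  shows "sublinear p"
  unfolding sublinear_def
proof (intro conjI allI impI add)
  fix t :: real and x :: 'a
  assume "t \<ge> 0"
  show "p (t *\<^sub>R x) = t * p x"
  proof (cases "t = 0")
    case False
    with \<open>t \<ge> 0\<close> have t: "t > 0" by simp
    have "(1 / t) * p (t *\<^sub>R x) \<le> p x"
      using scale[of "1 / t" "t *\<^sub>R x"] t by simp
    then have "p (t *\<^sub>R x) \<le> t * p x"
      using t by (simp add: field_simps)
    with scale[OF t, of x] show ?thesis by simp
  qed (simp add: zero)
qed

lemma sublinear_zero: "sublinear p \<Longrightarrow> p 0 = 0"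
  unfolding sublinear_def by (metis mult_zero_left order_refl scaleR_zero_left)

lemma sublinear_minus_le: "sublinear p \<Longrightarrow> - p (- x) \<le> p x"
  using sublinear_zero[of p] unfolding sublinear_def
  by (smt (verit, best) add.right_inverse)

text \<open>The chain condition serves subadditivity: the smaller of two members \<open>q\<close>
  and \<open>r\<close> lies below both and can be applied to both summands at once.\<close>

lemma sublinear_chain_Inf:
  fixes Q :: "('a::real_vector \<Rightarrow> real) set"
  assumes ne: "Q \<noteq> {}" and sub: "\<And>q. q \<in> Q \<Longrightarrow> sublinear q"
    and bdd: "\<And>x. bdd_below ((\<lambda>q. q x) ` Q)"
    and chain: "\<And>q r. q \<in> Q \<Longrightarrow> r \<in> Q \<Longrightarrow> q \<le> r \<or> r \<le> q"
  shows "sublinear (\<lambda>x. INF q\<in>Q. q x)"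
proof (rule sublinearI)
  fix x y
  have "(INF q\<in>Q. q (x + y)) - q x \<le> r y" if qr: "q \<in> Q" "r \<in> Q" for q r
  proof -
    obtain s where s: "s \<in> Q" "s \<le> q" "s \<le> r"
      using chain[OF qr] qr by blast
    have "(INF q\<in>Q. q (x + y)) \<le> s (x + y)"
      using s bdd by (intro cINF_lower)
    also have "\<dots> \<le> s x + s y"
      using sub[OF s(1)] by (simp add: sublinear_def)
    also have "\<dots> \<le> q x + r y"
      using s by (intro add_mono) (auto simp: le_fun_def)
    finally show ?thesis by simp
  qed
  then have "(INF q\<in>Q. q (x + y)) - q x \<le> (INF q\<in>Q. q y)" if "q \<in> Q" for q
    using ne that by (intro cINF_greatest)
  then have "(INF q\<in>Q. q (x + y)) - (INF q\<in>Q. q y) \<le> (INF q\<in>Q. q x)"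
    using ne by (intro cINF_greatest) (auto simp: algebra_simps)
  then show "(INF q\<in>Q. q (x + y)) \<le> (INF q\<in>Q. q x) + (INF q\<in>Q. q y)"
    by simp
next
  have "(\<lambda>q. q 0) ` Q = (\<lambda>q. 0) ` Q"
    by (intro image_cong refl sublinear_zero sub)
  then have "(\<lambda>q. q 0) ` Q = {0}"
    using ne by auto
  then show "(INF q\<in>Q. q 0) = 0" by simp
next
  fix t :: real and x assume t: "t > 0"
  show "t * (INF q\<in>Q. q x) \<le> (INF q\<in>Q. q (t *\<^sub>R x))"
  proof (rule cINF_greatest[OF ne])
    fix q assume q: "q \<in> Q"
    then have "(INF q\<in>Q. q x) \<le> q x"
      using bdd by (intro cINF_lower)
    then show "t * (INF q\<in>Q. q x) \<le> q (t *\<^sub>R x)"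
      using sub[OF q] t by (simp add: sublinear_def)
  qed
qed

text \<open>A minimal sublinear \<open>q\<close> must coincide with \<open>r x\<close>, which is
  sublinear and below \<open>q\<close>. The last bound then reads
  \<open>q y + q x \<le> q (y + x)\<close>, so a minimal \<open>q\<close> is additive.\<close>

lemma sublinear_shift_Inf:
  fixes q :: "'a::real_vector \<Rightarrow> real"
  assumes q: "sublinear q"
  defines "r \<equiv> \<lambda>x y. INF t\<in>{0..}. q (y + t *\<^sub>R x) - t * q x"
  shows "sublinear (r x)" and "r x y \<le> q y" and "r x y \<le> q (y + x) - q x"
proof -
  have r_eq: "r x y = (INF t\<in>{0..}. q (y + t *\<^sub>R x) - t * q x)" for x y
    by (simp add: r_def)
  have add: "q (u + v) \<le> q u + q v" for u v
    using q by (simp add: sublinear_def)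
  have scale: "q (t *\<^sub>R u) = t * q u" if "t \<ge> 0" for t u
    using q that by (simp add: sublinear_def)
  have lower: "- q (- y) \<le> q (y + t *\<^sub>R x) - t * q x" if "t \<ge> 0" for t y
    using add[of "y + t *\<^sub>R x" "- y"] scale[OF that, of x] by simp
  have bdd: "bdd_below ((\<lambda>t. q (y + t *\<^sub>R x) - t * q x) ` {0..})" for y
    using lower by (intro bdd_belowI[of _ "- q (- y)"]) auto
  have le: "r x y \<le> q (y + t *\<^sub>R x) - t * q x" if "t \<ge> 0" for t y
    unfolding r_eq using that bdd by (intro cINF_lower) auto
  show "r x y \<le> q y" using le[of 0] by simp
  show "r x y \<le> q (y + x) - q x" using le[of 1] by simp
  show "sublinear (r x)"
  proof (rule sublinearI)
    fix u v
    have "r x (u + v) - (q (u + s *\<^sub>R x) - s * q x) \<le> q (v + t *\<^sub>R x) - t * q x"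
      if "s \<ge> 0" "t \<ge> 0" for s t
      using le[of "s + t" "u + v"] add[of "u + s *\<^sub>R x" "v + t *\<^sub>R x"] that
      by (simp add: algebra_simps)
    then have "r x (u + v) - (q (u + s *\<^sub>R x) - s * q x) \<le> r x v" if "s \<ge> 0" for s
      unfolding r_eq[of x v] using that by (intro cINF_greatest) auto
    then have "r x (u + v) - r x v \<le> r x u"
      unfolding r_eq[of x u] by (intro cINF_greatest) (auto simp: algebra_simps)
    then show "r x (u + v) \<le> r x u + r x v" by simp
  next
    have "r x 0 \<le> 0" using le[of 0 0] sublinear_zero[OF q] by simp
    moreover have "0 \<le> r x 0"
      unfolding r_eq using scale by (intro cINF_greatest) auto
    ultimately show "r x 0 = 0" by simp
  next
    fix t :: real and y assume t: "t > 0"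
    show "t * r x y \<le> r x (t *\<^sub>R y)"
      unfolding r_eq[of x "t *\<^sub>R y"]
    proof (rule cINF_greatest)
      fix s :: real assume "s \<in> {0..}"
      then have "t * r x y \<le> t * (q (y + (s / t) *\<^sub>R x) - (s / t) * q x)"
        using le[of "s / t" y] t by (intro mult_left_mono) auto
      also have "\<dots> = q (t *\<^sub>R y + s *\<^sub>R x) - s * q x"
        using scale[of t "y + (s / t) *\<^sub>R x"] t by (simp add: algebra_simps)
      finally show "t * r x y \<le> q (t *\<^sub>R y + s *\<^sub>R x) - s * q x" .
    qed simp
  qed
qed

text \<open>Zorn's lemma for the reversed order gives a minimal sublinear functional below
  \<open>p\<close>. Minimality makes it additive, and an additive sublinear functional is
  linear.\<close>

theorem sublinear_dominates_linear:
  fixes p :: "'a::real_vector \<Rightarrow> real"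
  assumes p: "sublinear p"
  obtains f where "linear f" and "\<And>x. f x \<le> p x"
proof -
  define A where "A = {q. sublinear q \<and> q \<le> p}"
  have "partial_order_on A (relation_of (\<lambda>q r. r \<le> q) A)"
    by (rule partial_order_on_relation_ofI) auto
  moreover have "\<exists>u\<in>A. \<forall>q\<in>Q. u \<le> q" if Q: "Q \<in> Chains (relation_of (\<lambda>q r. r \<le> q) A)" for Q
  proof (cases "Q = {}")
    case True
    then show ?thesis using p by (auto simp: A_def)
  next
    case False
    have QA: "q \<in> A" if "q \<in> Q" for q
      using Q that by (auto simp: Chains_def relation_of_def)
    have chain: "q \<le> r \<or> r \<le> q" if "q \<in> Q" "r \<in> Q" for q r
      using Q that by (auto simp: Chains_def relation_of_def)
    \<comment> \<open>The bound does not depend on \<open>q\<close>, which keeps the pointwise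
      infimum over the chain finite.\<close>
    have lower: "- p (- x) \<le> q x" if "q \<in> Q" for q x
      using QA[OF that] sublinear_minus_le[of q x] unfolding A_def le_fun_def
      by (smt (verit, best) mem_Collect_eq)
    have bdd: "bdd_below ((\<lambda>q. q x) ` Q)" for x
      using lower by (intro bdd_belowI[of _ "- p (- x)"]) auto
    define u where "u = (\<lambda>x. INF q\<in>Q. q x)"
    have uq: "u \<le> q" if "q \<in> Q" for q
      unfolding u_def le_fun_def using that bdd by (auto intro!: cINF_lower)
    have "sublinear u"
      unfolding u_def using QA chain bdd False
      by (intro sublinear_chain_Inf) (auto simp: A_def)
    moreover have "u \<le> p"
      using False uq QA unfolding A_def by (metis (mono_tags) all_not_in_conv mem_Collect_eq order_trans)
    ultimately show ?thesis using uq by (auto simp: A_def)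
  qed
  ultimately obtain m where m: "m \<in> A" and min: "\<And>q. q \<in> A \<Longrightarrow> q \<le> m \<Longrightarrow> q = m"
    using predicate_Zorn[of A "\<lambda>q r. r \<le> q"] by blast
  have sub: "sublinear m" and mp: "m \<le> p"
    using m by (auto simp: A_def)
  have add: "m (y + x) = m y + m x" for x y
  proof (rule antisym)
    define r where "r = (\<lambda>x y. INF t\<in>{0..}. m (y + t *\<^sub>R x) - t * m x)"
    have r: "sublinear (r x)" "r x y \<le> m y" "r x y \<le> m (y + x) - m x" for x y
      unfolding r_def by (rule sublinear_shift_Inf[OF sub])+
    have "r x \<le> m"
      by (rule le_funI) (rule r(2))
    then have "r x = m"
      using r(1)[of x] mp by (intro min) (auto simp: A_def)
    then show "m y + m x \<le> m (y + x)"
      using r(3)[of x y] by simp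
  qed (use sub in \<open>simp add: sublinear_def\<close>)
  have neg: "m (- x) = - m x" for x
    using add[of x "- x"] sublinear_zero[OF sub] by simp
  have scale: "m (t *\<^sub>R x) = t * m x" for t x
  proof (cases "t \<ge> 0")
    case False
    then have "m ((- t) *\<^sub>R x) = (- t) * m x"
      using sub unfolding sublinear_def by (meson neg_0_le_iff_le linear)
    then show ?thesis by (simp add: neg)
  qed (use sub in \<open>simp add: sublinear_def\<close>)
  have "linear m"
    by (rule linearI) (simp_all add: add scale)
  then show ?thesis
    using that mp by (auto simp: le_fun_def)
qed

text \<open>The Mazur--Orlicz form of the Hahn--Banach theorem.\<close>

lemma hahn_banach_cone:
  fixes \<Lambda> :: "('a::real_normed_vector \<times> real) set"
  assumes zero: "(0, 0) \<in> \<Lambda>"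
    and add: "\<And>x r y s. (x, r) \<in> \<Lambda> \<Longrightarrow> (y, s) \<in> \<Lambda> \<Longrightarrow> (x + y, r + s) \<in> \<Lambda>"
    and scale: "\<And>t x r. t > 0 \<Longrightarrow> (x, r) \<in> \<Lambda> \<Longrightarrow> (t *\<^sub>R x, t * r) \<in> \<Lambda>"
    and bound: "\<And>x r. (x, r) \<in> \<Lambda> \<Longrightarrow> r \<le> M * norm x"
    and M: "M \<ge> 0"
  obtains f where "bounded_linear f" and "\<And>x. \<bar>f x\<bar> \<le> M * norm x"
    and "\<And>x r. (x, r) \<in> \<Lambda> \<Longrightarrow> r \<le> f x"
proof -
  \<comment> \<open>A linear functional lies below \<open>p\<close> exactly if it is at most
    \<open>M * norm x\<close> everywhere and at least \<open>r\<close> at \<open>y\<close> for every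
    \<open>(y, r) \<in> \<Lambda>\<close>: the first follows from the pair \<open>(0, 0)\<close>,
    the second from \<open>x = - y\<close>.\<close>
  define p where "p = (\<lambda>x. INF (y, r)\<in>\<Lambda>. M * norm (x + y) - r)"
  have lower: "- M * norm x \<le> M * norm (x + y) - r" if "(y, r) \<in> \<Lambda>" for x y r
  proof -
    have "M * norm y \<le> M * (norm (x + y) + norm x)"
      using norm_triangle_ineq4[of "x + y" x] M by (intro mult_left_mono) auto
    then show ?thesis using bound[OF that] by (simp add: algebra_simps)
  qed
  have bdd: "bdd_below ((\<lambda>(y, r). M * norm (x + y) - r) ` \<Lambda>)" for x
    using lower by (intro bdd_belowI[of _ "- M * norm x"]) auto
  have le: "p x \<le> M * norm (x + y) - r" if "(y, r) \<in> \<Lambda>" for x y r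
    unfolding p_def using cINF_lower[OF bdd that] by simp
  have ge: "c \<le> p x" if "\<And>y r. (y, r) \<in> \<Lambda> \<Longrightarrow> c \<le> M * norm (x + y) - r" for c x
    unfolding p_def using zero that by (intro cINF_greatest) auto
  have "sublinear p"
  proof (rule sublinearI)
    fix u v
    have "p (u + v) - (M * norm (u + y) - r) \<le> M * norm (v + z) - s"
      if "(y, r) \<in> \<Lambda>" "(z, s) \<in> \<Lambda>" for y r z s
    proof -
      have "M * norm (u + v + (y + z)) \<le> M * (norm (u + y) + norm (v + z))"
        using norm_triangle_ineq[of "u + y" "v + z"] M
        by (intro mult_left_mono) (auto simp: algebra_simps)
      then show ?thesis
        using le[OF add[OF that], of "u + v"] by (simp add: algebra_simps)
    qed
    then have "p (u + v) - (M * norm (u + y) - r) \<le> p v" if "(y, r) \<in> \<Lambda>" for y r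
      using that by (intro ge)
    then have "p (u + v) - p v \<le> p u"
      by (intro ge) (auto simp: algebra_simps)
    then show "p (u + v) \<le> p u + p v" by simp
  next
    have "p 0 \<le> 0" using le[OF zero, of 0] by simp
    moreover have "0 \<le> p 0" using bound by (intro ge) auto
    ultimately show "p 0 = 0" by simp
  next
    fix t :: real and x assume t: "t > 0"
    show "t * p x \<le> p (t *\<^sub>R x)"
    proof (rule ge)
      fix y r assume "(y, r) \<in> \<Lambda>"
      then have "((1 / t) *\<^sub>R y, (1 / t) * r) \<in> \<Lambda>"
        using t by (intro scale) auto
      from le[OF this, of x] have "t * p x \<le> t * (M * norm (x + (1 / t) *\<^sub>R y) - (1 / t) * r)"
        using t by simp
      also have "\<dots> = M * (\<bar>t\<bar> * norm (x + (1 / t) *\<^sub>R y)) - r"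
        using t by (simp add: right_diff_distrib mult.left_commute)
      also have "\<dots> = M * norm (t *\<^sub>R x + y) - r"
        unfolding norm_scaleR[symmetric] using t by (simp add: scaleR_add_right)
      finally show "t * p x \<le> M * norm (t *\<^sub>R x + y) - r" .
    qed
  qed
  then obtain f where f: "linear f" "\<And>x. f x \<le> p x"
    by (rule sublinear_dominates_linear) auto
  have upper: "f x \<le> M * norm x" for x
    using f(2)[of x] le[OF zero, of x] by simp
  have abs: "\<bar>f x\<bar> \<le> M * norm x" for x
    using upper[of x] upper[of "- x"] linear_neg[OF f(1), of x] by auto
  have "r \<le> f x" if "(x, r) \<in> \<Lambda>" for x r
    using f(2)[of "- x"] le[OF that, of "- x"] linear_neg[OF f(1), of x] by simp
  moreover have "bounded_linear f"
    using f(1) abs by (intro bounded_linear.intro bounded_linear_axioms.intro)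
      (auto simp: mult.commute)
  ultimately show ?thesis using that abs by blast
qed

section \<open>Norming and separating functionals\<close>

lemma norming_functional:
  fixes v :: "'a::real_normed_vector"
  obtains f where "bounded_linear f" and "\<And>x. \<bar>f x\<bar> \<le> norm x" and "f v = norm v"
proof -
  define \<Lambda> where "\<Lambda> = {(t *\<^sub>R v, t * norm v) | t. t \<ge> (0::real)}"
  obtain f where f: "bounded_linear f" "\<And>x. \<bar>f x\<bar> \<le> 1 * norm x"
      "\<And>x r. (x, r) \<in> \<Lambda> \<Longrightarrow> r \<le> f x"
  proof (rule hahn_banach_cone[of \<Lambda> 1])
    show "(0, 0) \<in> \<Lambda>" unfolding \<Lambda>_def by force
    show "(x + y, r + s) \<in> \<Lambda>" if "(x, r) \<in> \<Lambda>" "(y, s) \<in> \<Lambda>" for x r y s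
      using that unfolding \<Lambda>_def
      by (auto simp flip: scaleR_add_left distrib_right)
    show "(t *\<^sub>R x, t * r) \<in> \<Lambda>" if "t > 0" "(x, r) \<in> \<Lambda>" for t x r
      using that unfolding \<Lambda>_def by (force intro: exI[of _ "t * _"])
  qed (auto simp: \<Lambda>_def)
  have "(v, norm v) \<in> \<Lambda>" unfolding \<Lambda>_def by (force intro: exI[of _ 1])
  from f(3)[OF this] f(2)[of v] have "f v = norm v" by simp
  with f that show ?thesis by simp
qed

text \<open>The cone is generated by the differences \<open>x0 - k\<close>, on which the functional
  is required to be at least the distance bound \<open>d\<close>. Convexity of \<open>K\<close>
  closes the cone under addition: two generators merge into one at a weighted mean of their
  points.\<close>

lemma separation_closed_convex:
  fixes K :: "'a::real_normed_vector set"
  assumes K: "convex K" "closed K" "x0 \<notin> K"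
  obtains f :: "'a \<Rightarrow> real" and d where "bounded_linear f" and "d > 0"
    and "\<And>k. k \<in> K \<Longrightarrow> f k + d \<le> f x0"
proof (cases "K = {}")
  case True
  then show ?thesis using that[of "\<lambda>_. 0" 1] by simp
next
  case False
  then obtain k0 where k0: "k0 \<in> K" by blast
  obtain d where d: "d > 0" "\<And>k. k \<in> K \<Longrightarrow> d \<le> norm (x0 - k)"
  proof -
    have "open (- K)" "x0 \<in> - K" using K by auto
    then obtain e where "e > 0" "ball x0 e \<subseteq> - K"
      using open_contains_ball by blast
    then show ?thesis
      by (intro that[of e]) (force simp: subset_iff dist_norm not_less)+
  qed
  define \<Lambda> where "\<Lambda> = {(x, r). \<exists>t\<ge>0. \<exists>k\<in>K. x = t *\<^sub>R (x0 - k) \<and> r \<le> t * d}"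
  have \<Lambda>I: "(t *\<^sub>R (x0 - k), r) \<in> \<Lambda>" if "t \<ge> 0" "k \<in> K" "r \<le> t * d" for t k r
    unfolding \<Lambda>_def using that by blast
  have \<Lambda>E: thesis if "(x, r) \<in> \<Lambda>"
    and "\<And>t k. x = t *\<^sub>R (x0 - k) \<Longrightarrow> t \<ge> 0 \<Longrightarrow> k \<in> K \<Longrightarrow> r \<le> t * d \<Longrightarrow> thesis" for x r thesis
    using that unfolding \<Lambda>_def by blast
  obtain f where f: "bounded_linear f" "\<And>x. \<bar>f x\<bar> \<le> 1 * norm x"
      "\<And>x r. (x, r) \<in> \<Lambda> \<Longrightarrow> r \<le> f x"
  proof (rule hahn_banach_cone[of \<Lambda> 1])
    show "(0, 0) \<in> \<Lambda>" using \<Lambda>I[of 0 k0 0] k0 by simp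
  next
    fix x r y s assume "(x, r) \<in> \<Lambda>" "(y, s) \<in> \<Lambda>"
    then obtain t k u l where *: "t \<ge> 0" "u \<ge> 0" "k \<in> K" "l \<in> K" "r \<le> t * d" "s \<le> u * d"
      and xy: "x = t *\<^sub>R (x0 - k)" "y = u *\<^sub>R (x0 - l)"
      by (elim \<Lambda>E) blast
    show "(x + y, r + s) \<in> \<Lambda>"
    proof (cases "t + u = 0")
      case True
      with * have "t = 0" "u = 0" by auto
      then show ?thesis using \<Lambda>I[of 0 k "r + s"] * xy by simp
    next
      case False
      with * have tu: "t + u > 0" by simp
      define m where "m = (t / (t + u)) *\<^sub>R k + (u / (t + u)) *\<^sub>R l"
      have "m \<in> K"
        unfolding m_def using * tu
        by (intro convexD[OF K(1)]) (auto simp flip: add_divide_distrib)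
      moreover have "(t + u) *\<^sub>R m = t *\<^sub>R k + u *\<^sub>R l"
        unfolding m_def using tu by (simp add: scaleR_add_right)
      then have "(t + u) *\<^sub>R (x0 - m) = x + y"
        by (simp add: xy scaleR_diff_right scaleR_add_left)
      moreover have "r + s \<le> (t + u) * d"
        using *(5,6) by (simp add: distrib_right)
      ultimately show ?thesis
        using \<Lambda>I[of "t + u" m "r + s"] tu by simp
    qed
  next
    fix t :: real and x r assume t: "t > 0" and "(x, r) \<in> \<Lambda>"
    then obtain u k where "u \<ge> 0" "k \<in> K" "r \<le> u * d" "x = u *\<^sub>R (x0 - k)"
      by (elim \<Lambda>E) blast
    then show "(t *\<^sub>R x, t * r) \<in> \<Lambda>"
      using \<Lambda>I[of "t * u" k "t * r"] t by simp
  next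
    fix x r assume "(x, r) \<in> \<Lambda>"
    then obtain u k where "u \<ge> 0" "k \<in> K" "r \<le> u * d" "x = u *\<^sub>R (x0 - k)"
      by (elim \<Lambda>E) blast
    then show "r \<le> 1 * norm x"
      using mult_left_mono[OF d(2)[of k], of u] by simp
  qed auto
  show ?thesis
  proof (rule that[of f d])
    show "bounded_linear f" "d > 0" by fact+
    fix k assume "k \<in> K"
    then have "(x0 - k, d) \<in> \<Lambda>"
      using \<Lambda>I[of 1 k d] by simp
    from f(3)[OF this] show "f k + d \<le> f x0"
      by (simp add: linear_diff[OF bounded_linear.linear[OF f(1)]])
  qed
qed

section \<open>Directions and slopes\<close>

text \<open>Both scalar fields at once: \<open>re\<close> is the identity on \<open>real\<close> and the real part on \<open>complex\<close>.\<close>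

locale scalar_structure =
  fixes sc :: "'k::{real_normed_field, euclidean_space} \<Rightarrow> 'a::real_normed_vector \<Rightarrow> 'a"
    and re :: "'k \<Rightarrow> real"
  assumes sc_add_left: "sc (c + d) x = sc c x + sc d x"
    and sc_add_right: "sc c (x + y) = sc c x + sc c y"
    and sc_sc: "sc c (sc d x) = sc (c * d) x"
    and sc_of_real: "sc (of_real r) x = r *\<^sub>R x"
    and norm_sc: "norm (sc c x) = norm c * norm x"
    and linear_re: "linear re"
    and abs_re_le: "\<bar>re c\<bar> \<le> norm c"
    and re_one: "re 1 = 1"
    and ex_dual_re: "bounded_linear g \<Longrightarrow> \<exists>f\<in>dual_space sc. \<forall>x. re (f x) = g x"
begin

lemma sc_one: "sc 1 x = x"
  using sc_of_real[of 1 x] by simp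

lemma sc_zero: "sc 0 x = 0"
  using sc_of_real[of 0 x] by simp

lemma sc_scaleR_left: "sc (r *\<^sub>R c) x = r *\<^sub>R sc c x"
  by (simp add: scaleR_conv_of_real flip: sc_sc sc_of_real)

lemma sc_scaleR_right: "sc c (r *\<^sub>R x) = r *\<^sub>R sc c x"
  by (simp only: sc_of_real[symmetric] sc_sc mult.commute)

lemma bounded_linear_sc_left: "bounded_linear (\<lambda>c. sc c x)"
  by (rule bounded_linear_intro[where K = "norm x"])
    (simp_all add: sc_add_left sc_scaleR_left norm_sc)

lemma bounded_linear_sc_right: "bounded_linear (sc c)"
  by (rule bounded_linear_intro[where K = "norm c"])
    (simp_all add: sc_add_right sc_scaleR_right norm_sc)

lemma re_of_real: "re (of_real r) = r"
  using linear_scale[OF linear_re, of r 1] re_one by (simp add: scaleR_conv_of_real)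

section \<open>The slice form of the Daugavet property\<close>

lemma rank_one_operator_tensor:
  assumes f: "f \<in> dual_space sc" "f z \<noteq> 0" and "w \<noteq> 0"
  shows "rank_one_operator sc (\<lambda>x. sc (f x) w)"
  unfolding rank_one_operator_def
proof (intro conjI allI exI[of _ w])
  have bl: "bounded_linear f" and hom: "\<And>c x. f (sc c x) = c * f x"
    using f by (auto simp: dual_space_def)
  show "bounded_linear (\<lambda>x. sc (f x) w)"
    using bounded_linear_compose[OF bounded_linear_sc_left bl] .
  show "sc (f (sc c x)) w = sc c (sc (f x) w)" for c x
    by (simp add: hom sc_sc)
  have "c \<in> range f" for c
    using hom[of "c / f z" z] f(2) by (intro range_eqI[of _ _ "sc (c / f z) z"]) simp
  then have "range f = UNIV" by blast
  then show "range (\<lambda>x. sc (f x) w) = range (\<lambda>c. sc c w)"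
    using image_image[of "\<lambda>c. sc c w" f UNIV] by simp
qed fact

text \<open>With \<open>K\<close> the norm of \<open>f\<close>, the rank-one operator sending
  \<open>x\<close> to \<open>f x / K\<close> times \<open>v\<close> has norm at least
  \<open>norm v\<close>. A unit vector \<open>x\<close> with \<open>norm (x + R x)\<close> almost
  \<open>1 + norm v\<close> must have \<open>norm (f x)\<close> almost \<open>K\<close>. After a
  rotation by a scalar, \<open>R x\<close> is almost \<open>v\<close>, and \<open>g x\<close> is
  almost as large as \<open>g\<close> can be on the unit ball.\<close>

lemma daugavet_direction_nonzero:
  fixes g :: "'a \<Rightarrow> real"
  assumes daugavet: "daugavet_property sc" and g: "bounded_linear g" "g z \<noteq> 0"
    and x0: "norm x0 \<le> 1" and v: "v \<noteq> 0" and d: "d > 0"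
  shows "\<exists>x. norm x = 1 \<and> norm v + 1 - d \<le> norm (v + x) \<and> g x0 - d \<le> g x"
proof -
  obtain f where f: "f \<in> dual_space sc" and ref: "\<And>x. re (f x) = g x"
    using ex_dual_re[OF g(1)] by auto
  have bl: "bounded_linear f" and hom: "\<And>c x. f (sc c x) = c * f x"
    using f by (auto simp: dual_space_def)
  have fz: "f z \<noteq> 0"
    using ref[of z] g(2) linear_0[OF linear_re] by force
  define K where "K = onorm f"
  have fK: "norm (f x) \<le> K * norm x" for x
    unfolding K_def by (rule onorm[OF bl])
  have K: "K > 0"
    unfolding K_def using fz by (subst onorm_pos_lt[OF bl]) auto
  define w where "w = (1 / K) *\<^sub>R v"
  have w: "w \<noteq> 0" "norm w = norm v / K" using v K by (auto simp: w_def)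
  define R where "R = (\<lambda>x. sc (f x) w)"
  have rank: "rank_one_operator sc R"
    unfolding R_def using f fz w(1) by (rule rank_one_operator_tensor)
  then have blR: "bounded_linear R" by (simp add: rank_one_operator_def)
  have "K \<le> onorm R / norm w"
    unfolding K_def
  proof (rule onorm_bound)
    show "0 \<le> onorm R / norm w" using onorm_pos_le[OF blR] by simp
    show "norm (f x) \<le> onorm R / norm w * norm x" for x
      using onorm[OF blR, of x] w(1) by (simp add: R_def norm_sc field_simps)
  qed
  then have onR: "norm v \<le> onorm R" using w K v by (simp add: field_simps)
  have "d * norm v / K > 0" "norm v > 0" using d v K by simp_all
  \<comment> \<open>The bound \<open>1 / 2\<close> keeps the factor of \<open>norm x\<close> below
    nonnegative, \<open>d / 2\<close> leaves room for two errors in the norm estimate,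
    \<open>norm v / 2\<close> forces \<open>f x \<noteq> 0\<close>, and the last bound turns the
    relative loss in \<open>n\<close> into \<open>K - d \<le> n\<close>.\<close>
  define \<epsilon> where "\<epsilon> = min (min (1 / 2) (d / 2)) (min (norm v / 2) (d * norm v / K))"
  have \<epsilon>: "\<epsilon> > 0" "\<epsilon> \<le> 1 / 2" "\<epsilon> \<le> d / 2" "\<epsilon> \<le> norm v / 2" "\<epsilon> \<le> d * norm v / K"
    unfolding \<epsilon>_def using d \<open>d * norm v / K > 0\<close> \<open>norm v > 0\<close> by linarith+
  have "\<exists>x. norm (x + R x) > (1 + norm v - \<epsilon>) * norm x"
  proof (rule ccontr)
    assume "\<nexists>x. norm (x + R x) > (1 + norm v - \<epsilon>) * norm x"
    then have "onorm (\<lambda>x. x + R x) \<le> 1 + norm v - \<epsilon>"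
      using \<epsilon> by (intro onorm_bound) (auto simp: not_less add_increasing2)
    then show False
      using daugavet rank onR \<epsilon>(1) by (auto simp: daugavet_property_def)
  qed
  then obtain x1 where x1: "norm (x1 + R x1) > (1 + norm v - \<epsilon>) * norm x1" by blast
  then have x1_nz: "x1 \<noteq> 0"
    using linear_0[OF bounded_linear.linear[OF blR]] by auto
  define x where "x = x1 /\<^sub>R norm x1"
  have nx: "norm x = 1" using x1_nz by (simp add: x_def)
  have "x + R x = (x1 + R x1) /\<^sub>R norm x1"
    by (simp add: x_def linear_scale[OF bounded_linear.linear[OF blR]] scaleR_add_right)
  then have "norm (x + R x) = norm (x1 + R x1) / norm x1"
    by (simp add: divide_inverse mult.commute)
  then have big: "norm (x + R x) > 1 + norm v - \<epsilon>"
    using x1 x1_nz by (simp add: pos_less_divide_eq)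
  define n where "n = norm (f x)"
  have nK: "n \<le> K" using fK[of x] nx by (simp add: n_def)
  have "norm (x + R x) \<le> 1 + n * (norm v / K)"
    using norm_triangle_ineq[of x "R x"] nx w by (simp add: R_def norm_sc n_def)
  with big have "norm v - \<epsilon> < n * norm v / K" by simp
  then have nbig: "(norm v - \<epsilon>) * K < n * norm v"
    using K by (simp add: field_simps)
  have "norm v - \<epsilon> > 0" using \<epsilon>(4) v zero_less_norm_iff[of v] by linarith
  then have "(norm v - \<epsilon>) * K > 0" using K by simp
  with nbig have "n * norm v > 0" by linarith
  then have fx: "f x \<noteq> 0" by (auto simp: n_def)
  \<comment> \<open>A scalar of modulus one makes the value of \<open>f\<close> real and
    nonnegative, so that \<open>g\<close> sees all of \<open>norm (f x)\<close>, and it leaves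
    \<open>norm (x + R x)\<close> unchanged.\<close>
  define c where "c = of_real n / f x"
  have nc: "norm c = 1" using fx by (simp add: c_def n_def norm_divide)
  define y where "y = sc c x"
  have ny: "norm y = 1" using nc nx by (simp add: y_def norm_sc)
  have fy: "f y = of_real n" using fx by (simp add: y_def hom c_def)
  have gy: "g y = n" using ref[of y] by (simp add: fy re_of_real)
  have "y + R y = sc c (x + R x)"
    by (simp add: y_def R_def hom sc_sc sc_add_right)
  then have "norm (y + R y) = norm (x + R x)" using nc by (simp add: norm_sc)
  moreover have Ry: "R y = (n / K) *\<^sub>R v" by (simp add: R_def fy sc_of_real w_def)
  moreover have "norm (y + R y) \<le> norm (v + y) + (1 - n / K) * norm v"
  proof -
    have "y + (n / K) *\<^sub>R v = (v + y) - (1 - n / K) *\<^sub>R v" by (simp add: algebra_simps)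
    then have "norm (y + (n / K) *\<^sub>R v) \<le> norm (v + y) + norm ((1 - n / K) *\<^sub>R v)"
      by (metis norm_triangle_ineq4)
    then show ?thesis unfolding Ry using nK K by simp
  qed
  moreover have "(1 - n / K) * norm v \<le> \<epsilon>"
    using nbig K by (simp add: field_simps)
  ultimately have "norm v + 1 - d \<le> norm (v + y)"
    using big \<epsilon> by linarith
  moreover have "g x0 - d \<le> g y"
  proof -
    have "g x0 \<le> K"
      using abs_re_le[of "f x0"] fK[of x0] ref[of x0] mult_left_mono[OF x0, of K] K by linarith
    moreover have "\<epsilon> * K \<le> d * norm v" using \<epsilon>(5) K by (simp add: field_simps)
    then have "(K - d) * norm v \<le> n * norm v" using nbig by (simp add: algebra_simps)
    then have "K - d \<le> n" using v by simp
    ultimately show ?thesis using gy by simp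
  qed
  ultimately show ?thesis using ny by blast
qed

text \<open>If \<open>g\<close> vanishes identically, the norming functional of \<open>v\<close>
  takes its place and the last inequality becomes \<open>- d \<le> 0\<close>.\<close>

lemma daugavet_direction:
  fixes g :: "'a \<Rightarrow> real"
  assumes "daugavet_property sc" and "bounded_linear g"
    and "norm x0 \<le> 1" and "v \<noteq> 0" and "d > 0"
  shows "\<exists>x. norm x = 1 \<and> norm v + 1 - d \<le> norm (v + x) \<and> g x0 - d \<le> g x"
proof (cases "\<exists>z. g z \<noteq> 0")
  case True
  then show ?thesis using daugavet_direction_nonzero assms by blast
next
  case False
  obtain h where h: "bounded_linear h" "h v = norm v"
    by (rule norming_functional[of v]) (rule that)
  then have "h v \<noteq> 0" using \<open>v \<noteq> 0\<close> by simp
  from daugavet_direction_nonzero[OF assms(1) h(1) this assms(3-5)]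
  show ?thesis using False \<open>d > 0\<close> by auto
qed

end

section \<open>Slopes with their directions, and almost l1-orthogonal directions\<close>

definition slope_pairs :: "('a::real_normed_vector \<Rightarrow> 'a) \<Rightarrow> ('a \<times> 'a) set" where
  "slope_pairs T = {((x1 - x2) /\<^sub>R norm (x1 - x2), (T x1 - T x2) /\<^sub>R norm (x1 - x2)) | x1 x2. x1 \<noteq> x2}"

lemma slope_pairsI:
  "x1 \<noteq> x2 \<Longrightarrow>
    ((x1 - x2) /\<^sub>R norm (x1 - x2), (T x1 - T x2) /\<^sub>R norm (x1 - x2)) \<in> slope_pairs T"
  unfolding slope_pairs_def by blast

lemma slope_eq_image: "slope T = snd ` slope_pairs T"
  unfolding slope_def slope_pairs_def by force

lemma norm_fst_slope_pairs: "(e, s) \<in> slope_pairs T \<Longrightarrow> norm e = 1"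
  by (auto simp: slope_pairs_def)

text \<open>For a unit vector \<open>e\<close> the triangle inequality is thus almost an equality,
  which is almost l1-orthogonality to \<open>N\<close>. Coefficient one in front of \<open>e\<close>
  is enough because nets of combinations and homogeneity supply the others.\<close>

definition l1_far :: "real \<Rightarrow> 'a::real_normed_vector set \<Rightarrow> 'a set" where
  "l1_far d N = {e. \<forall>v\<in>N. norm v + 1 - d \<le> norm (v + e)}"

lemma l1_far_mono: "d \<le> d' \<Longrightarrow> l1_far d N \<subseteq> l1_far d' N"
  unfolding l1_far_def by (intro Collect_mono impI ballI) (drule (1) bspec, simp)

locale lipschitz_daugavet =
  fixes T :: "'a::real_normed_vector \<Rightarrow> 'a"
  assumes continuous_T: "continuous_on UNIV T"
    and nonzero: "\<exists>x::'a. x \<noteq> 0"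
    and direction: "\<And>g (x0::'a) v d. bounded_linear g \<Longrightarrow> norm x0 \<le> 1 \<Longrightarrow> v \<noteq> 0 \<Longrightarrow> d > 0 \<Longrightarrow>
      \<exists>x. norm x = 1 \<and> norm v + 1 - d \<le> norm (v + x) \<and> g x0 - d \<le> (g x :: real)"
begin

text \<open>Induction on the finite set. If \<open>x\<close> is good for the new vector
  \<open>v\<close>, a norming functional \<open>h\<close> of \<open>v + x\<close> is almost
  \<open>1\<close> at \<open>x\<close> and almost \<open>norm v\<close> at \<open>v\<close>.
  Applying the induction hypothesis to \<open>g + L * h\<close> at \<open>x\<close> yields a
  \<open>y\<close> that handles \<open>N\<close>, stays in the half-space of \<open>g\<close>, and
  has \<open>h y\<close> close to \<open>1\<close>, hence is also far from \<open>v\<close>.\<close>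

lemma direction_finite:
  fixes g :: "'a \<Rightarrow> real" and x0 :: 'a
  assumes "finite N" and "bounded_linear g" and "norm x0 \<le> 1" and "d > 0"
  shows "\<exists>x. norm x = 1 \<and> x \<in> l1_far d N \<and> g x0 - d \<le> g x"
  using assms
proof (induction N arbitrary: g x0 d rule: finite_induct)
  case empty
  obtain v :: 'a where "v \<noteq> 0" using nonzero by blast
  from direction[OF empty(1,2) this empty(3)] show ?case by (auto simp: l1_far_def)
next
  case (insert v N)
  show ?case
  proof (cases "v = 0")
    case True
    obtain x where "norm x = 1" "x \<in> l1_far d N" "g x0 - d \<le> g x"
      using insert.IH[OF insert.prems] by blast
    with True insert.prems(3) show ?thesis by (intro exI[of _ x]) (auto simp: l1_far_def)
  next
    case False
    obtain B where B: "B > 0" "\<And>x. norm (g x) \<le> norm x * B"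
      using bounded_linear.pos_bounded[OF insert.prems(1)] by blast
    \<comment> \<open>The weight \<open>L\<close> is so large that \<open>g\<close>, bounded by
      \<open>B\<close> on unit vectors, cannot compensate a loss of more than
      \<open>3 * d / 4\<close> in \<open>h\<close>. In turn
      \<open>\<delta> \<le> d / (L + 2)\<close> keeps the total loss in \<open>g\<close> below
      \<open>d\<close>.\<close>
    define L where "L = 4 * B / d"
    have L: "L > 0" using B insert.prems by (simp add: L_def)
    have "d / (L + 2) > 0" using L insert.prems(3) by simp
    define \<delta> where "\<delta> = min (d / 8) (min B (d / (L + 2)))"
    have \<delta>: "\<delta> > 0" "\<delta> \<le> d / 8" "\<delta> \<le> B" "\<delta> \<le> d / (L + 2)"
      unfolding \<delta>_def using B(1) \<open>d / (L + 2) > 0\<close> insert.prems(3) by linarith+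
    obtain x where x: "norm x = 1" "norm v + 1 - \<delta> \<le> norm (v + x)" "g x0 - \<delta> \<le> g x"
      using direction[OF insert.prems(1,2) False \<delta>(1)] by blast
    obtain h where h: "bounded_linear h" "\<And>x. \<bar>h x\<bar> \<le> norm x" "h (v + x) = norm (v + x)"
      by (rule norming_functional[of "v + x"]) (rule that)
    have hvx: "h v + h x = norm (v + x)"
      using h(3) linear_add[OF bounded_linear.linear[OF h(1)]] by simp
    have hx: "h x \<ge> 1 - \<delta>" and hv: "h v \<ge> norm v - \<delta>"
      using h(2)[of v] h(2)[of x] x hvx by auto
    have "bounded_linear (\<lambda>x. g x + L * h x)"
      using insert.prems(1) h(1) by (intro bounded_linear_add bounded_linear_const_mult)
    from insert.IH[OF this _ \<delta>(1), of x] x(1)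
    obtain y where y: "norm y = 1" "y \<in> l1_far \<delta> N"
        "g x + L * h x - \<delta> \<le> g y + L * h y" by auto
    have hy1: "h y \<le> 1" using h(2)[of y] y(1) by simp
    have gy: "g x0 - d \<le> g y"
    proof -
      have "L * h y \<le> L" "L * h x \<ge> L * (1 - \<delta>)"
        using hy1 hx L by (auto intro: mult_left_mono)
      then have "g y \<ge> g x - L * \<delta> - \<delta>" using y(3) by (simp add: algebra_simps)
      moreover have "(L + 2) * \<delta> \<le> d" using \<delta>(4) L by (simp add: field_simps)
      ultimately show ?thesis using x(3) by (simp add: algebra_simps)
    qed
    have "g y \<le> B" "- B \<le> g x" using B(2)[of y] B(2)[of x] x(1) y(1) by auto
    then have "L * (h x - h y) \<le> 3 * B" using y(3) \<delta>(3) by (simp add: algebra_simps)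
    then have "B * (4 * (h x - h y)) \<le> B * (3 * d)"
      using insert.prems(3) by (simp add: L_def field_simps)
    then have "4 * (h x - h y) \<le> 3 * d"
      using B(1) by (simp only: mult_le_cancel_left_pos)
    then have "norm v + 1 - d \<le> h (v + y)"
      using hx hv \<delta>(2) linear_add[OF bounded_linear.linear[OF h(1)], of v y] by simp
    then have "norm v + 1 - d \<le> norm (v + y)" using h(2)[of "v + y"] by linarith
    moreover have "y \<in> l1_far d N" using y(2) \<delta>(1,2) by (auto simp: l1_far_def)
    ultimately show ?thesis using y(1) gy by (intro exI[of _ y]) (auto simp: l1_far_def)
  qed
qed

text \<open>A ball point outside the hull would be separated from it by an open half-space, which
  contains one of the directions by \<open>direction_finite\<close>.\<close>

lemma cball_subset_closed_hull_directions:
  fixes N :: "'a set"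
  assumes "finite N" and "d > 0"
  shows "cball 0 1 \<subseteq> closure (convex hull {e \<in> l1_far d N. norm e = 1})"
proof
  fix x0 :: 'a assume x0: "x0 \<in> cball 0 1"
  show "x0 \<in> closure (convex hull {e \<in> l1_far d N. norm e = 1})" (is "_ \<in> ?K")
  proof (rule ccontr)
    assume "x0 \<notin> ?K"
    then obtain f :: "'a \<Rightarrow> real" and \<delta> where f: "bounded_linear f" "\<delta> > 0" "\<And>k. k \<in> ?K \<Longrightarrow> f k + \<delta> \<le> f x0"
      by (rule separation_closed_convex[OF convex_closure[OF convex_convex_hull] closed_closure]) blast
    obtain x where x: "norm x = 1" "x \<in> l1_far (min d (\<delta> / 2)) N" "f x0 - min d (\<delta> / 2) \<le> f x"
      using direction_finite[OF assms(1) f(1), of x0 "min d (\<delta> / 2)"] x0 assms(2) f(2) by auto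
    then have "x \<in> {e \<in> l1_far d N. norm e = 1}"
      using l1_far_mono[of "min d (\<delta> / 2)" d N] by auto
    then have "x \<in> ?K"
      by (intro closure_subset[THEN subsetD] hull_inc)
    from f(3)[OF this] x(3) f(2) show False by simp
  qed
qed

text \<open>If every slope in a far direction had \<open>g\<close>-value at most
  \<open>\<gamma>\<close>, then \<open>g\<close> of \<open>T\<close> would increase at rate at most
  \<open>\<gamma>\<close> along these directions, hence along their convex combinations and limits.
  Their closed hull contains the unit ball, so all slopes would obey the bound, whereas
  \<open>y0\<close> forces some slope beyond \<open>\<gamma>\<close>.\<close>

lemma slope_pair_in_half_space:
  fixes g :: "'a \<Rightarrow> real"
  assumes y0: "y0 \<in> closure (convex hull (slope T))"
    and g: "bounded_linear g" and \<theta>: "\<theta> > 0" and N: "finite N" "d > 0"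
  obtains e s where "(e, s) \<in> slope_pairs T" and "e \<in> l1_far d N" and "g y0 - \<theta> < g s"
proof -
  have lin: "linear g" by (rule bounded_linear.linear[OF g])
  have cont: "continuous_on UNIV g" by (rule linear_continuous_on[OF g])
  have quot: "g ((a - b) /\<^sub>R r) = (g a - g b) / r" for a b r
    by (simp add: linear_scale[OF lin] linear_diff[OF lin] divide_inverse mult.commute)
  define \<gamma> where "\<gamma> = g y0 - \<theta>"
  have "\<exists>s\<in>slope T. g s > \<gamma>"
  proof (rule ccontr)
    assume "\<not> ?thesis"
    then have "slope T \<subseteq> {x. g x \<le> \<gamma>}"
      by (auto simp: not_less)
    moreover have "convex {x. g x \<le> \<gamma>}"
      by (rule convexI) (simp add: linear_add[OF lin] linear_scale[OF lin] convex_bound_le)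
    moreover have "closed {x. g x \<le> \<gamma>}"
      using cont by (intro closed_Collect_le continuous_on_const) 
    ultimately have "closure (convex hull (slope T)) \<subseteq> {x. g x \<le> \<gamma>}"
      by (intro closure_minimal hull_minimal)
    then show False using y0 \<theta> by (auto simp: \<gamma>_def)
  qed
  then obtain x1 x2 where x12: "x1 \<noteq> x2" "g ((T x1 - T x2) /\<^sub>R norm (x1 - x2)) > \<gamma>"
    unfolding slope_def by blast
  have "\<exists>e s. (e, s) \<in> slope_pairs T \<and> e \<in> l1_far d N \<and> g y0 - \<theta> < g s"
  proof (rule ccontr)
    assume none: "\<not> ?thesis"
    have small: "g s \<le> \<gamma>" if "(e, s) \<in> slope_pairs T" "e \<in> l1_far d N" for e s
    proof (rule ccontr)
      assume "\<not> g s \<le> \<gamma>"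
      then have "g y0 - \<theta> < g s" by (simp add: \<gamma>_def)
      with none that show False by blast
    qed
    \<comment> \<open>Convexity of this set replaces the telescoping of the increments of \<open>T\<close> along a broken line.\<close>
    define H where "H = {w. \<forall>x. \<forall>r\<ge>0. g (T (x + r *\<^sub>R w)) - g (T x) \<le> \<gamma> * r}"
    have "convex H"
    proof (rule convexI)
      fix v w :: 'a and a b :: real
      assume vw: "v \<in> H" "w \<in> H" and ab: "0 \<le> a" "0 \<le> b" "a + b = 1"
      have "g (T (x + r *\<^sub>R (a *\<^sub>R v + b *\<^sub>R w))) - g (T x) \<le> \<gamma> * r" if "r \<ge> 0" for x r
      proof -
        have "g (T (x + (r * a) *\<^sub>R v)) - g (T x) \<le> \<gamma> * (r * a)"
          using vw(1) mult_nonneg_nonneg[OF that ab(1)] unfolding H_def by blast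
        moreover have "g (T ((x + (r * a) *\<^sub>R v) + (r * b) *\<^sub>R w)) - g (T (x + (r * a) *\<^sub>R v)) \<le> \<gamma> * (r * b)"
          using vw(2) mult_nonneg_nonneg[OF that ab(2)] unfolding H_def by blast
        moreover have "\<gamma> * (r * a) + \<gamma> * (r * b) = \<gamma> * r"
          using ab(3) by (simp flip: distrib_left)
        ultimately show ?thesis by (simp add: scaleR_add_right add.assoc)
      qed
      then show "a *\<^sub>R v + b *\<^sub>R w \<in> H" by (simp add: H_def)
    qed
    moreover have "closed H"
    proof -
      have "closed {w. g (T (x + r *\<^sub>R w)) - g (T x) \<le> \<gamma> * r}" for x r
      proof -
        have "continuous_on UNIV (\<lambda>w. T (x + r *\<^sub>R w))"
          by (rule continuous_on_compose2[OF continuous_T]) (auto intro!: continuous_intros)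
        then have "continuous_on UNIV (\<lambda>w. g (T (x + r *\<^sub>R w)))"
          by (rule continuous_on_compose2[OF cont]) auto
        then show ?thesis
          by (intro closed_Collect_le continuous_on_diff continuous_on_const)
      qed
      then show ?thesis unfolding H_def
        by (intro closed_Collect_all closed_Collect_imp) auto
    qed
    moreover have "{e \<in> l1_far d N. norm e = 1} \<subseteq> H"
    proof
      fix e assume e: "e \<in> {e \<in> l1_far d N. norm e = 1}"
      have "g (T (x + r *\<^sub>R e)) - g (T x) \<le> \<gamma> * r" if "r \<ge> 0" for x r
      proof (cases "r = 0")
        case False
        with that have r: "r > 0" by simp
        have "e \<noteq> 0" using e by auto
        have "(e, (T (x + r *\<^sub>R e) - T x) /\<^sub>R r) \<in> slope_pairs T"
          using slope_pairsI[of "x + r *\<^sub>R e" x T] e r \<open>e \<noteq> 0\<close> by simp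
        from small[OF this] e have "(g (T (x + r *\<^sub>R e)) - g (T x)) / r \<le> \<gamma>"
          by (simp add: quot)
        then show ?thesis using r by (simp add: pos_divide_le_eq)
      qed simp
      then show "e \<in> H" by (simp add: H_def)
    qed
    ultimately have "closure (convex hull {e \<in> l1_far d N. norm e = 1}) \<subseteq> H"
      by (intro closure_minimal hull_minimal)
    moreover have "(x1 - x2) /\<^sub>R norm (x1 - x2) \<in> cball 0 1"
      using x12(1) by simp
    ultimately have "(x1 - x2) /\<^sub>R norm (x1 - x2) \<in> H"
      using cball_subset_closed_hull_directions[OF N] by blast
    then have "g (T (x2 + norm (x1 - x2) *\<^sub>R ((x1 - x2) /\<^sub>R norm (x1 - x2)))) - g (T x2)
        \<le> \<gamma> * norm (x1 - x2)"
      unfolding H_def using norm_ge_zero[of "x1 - x2"] by blast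
    then have "g (T x1) - g (T x2) \<le> \<gamma> * norm (x1 - x2)"
      using x12(1) by simp
    then show False
      using x12 by (simp add: quot pos_less_divide_eq)
  qed
  then show ?thesis using that by blast
qed

end

section \<open>Perturbation of functionals\<close>

definition functional_ball :: "real \<Rightarrow> ('a::real_normed_vector \<Rightarrow> real) set" where
  "functional_ball K = {\<phi>. bounded_linear \<phi> \<and> (\<forall>x. \<bar>\<phi> x\<bar> \<le> K * norm x)}"

lemma functional_ball_mono: "K \<le> L \<Longrightarrow> functional_ball K \<subseteq> functional_ball L"
  unfolding functional_ball_def by (auto intro: order_trans[OF _ mult_right_mono])

section \<open>Finite nets of combinations and the perturbation of functionals\<close>

lemma compact_bounded_combinations:
  fixes F :: "'a::real_normed_vector set"
  assumes "finite F"
  shows "\<exists>Z. compact Z \<and> (\<forall>\<alpha>. (\<forall>w\<in>F. \<bar>\<alpha> w\<bar> \<le> R) \<longrightarrow> (\<Sum>w\<in>F. \<alpha> w *\<^sub>R w) \<in> Z)"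
  using assms
proof (induction F)
  case empty
  show ?case by (intro exI[of _ "{0}"]) simp
next
  case (insert u F)
  then obtain Z where Z: "compact Z"
      "\<And>\<alpha>. \<forall>w\<in>F. \<bar>\<alpha> w\<bar> \<le> R \<Longrightarrow> (\<Sum>w\<in>F. \<alpha> w *\<^sub>R w) \<in> Z"
    by blast
  define Y where "Y = {x + y | x y. x \<in> (\<lambda>r. r *\<^sub>R u) ` {-R..R} \<and> y \<in> Z}"
  have "compact ((\<lambda>r. r *\<^sub>R u) ` {-R..R})"
    by (intro compact_continuous_image continuous_intros compact_Icc)
  then have "compact Y"
    unfolding Y_def using Z(1) by (rule compact_sums)
  moreover have "(\<Sum>w\<in>insert u F. \<alpha> w *\<^sub>R w) \<in> Y" if "\<forall>w\<in>insert u F. \<bar>\<alpha> w\<bar> \<le> R" for \<alpha>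
  proof -
    have "\<alpha> u *\<^sub>R u \<in> (\<lambda>r. r *\<^sub>R u) ` {-R..R}"
      using that by (intro imageI) (auto simp: abs_le_iff)
    moreover have "(\<Sum>w\<in>F. \<alpha> w *\<^sub>R w) \<in> Z" using that by (intro Z(2)) auto
    ultimately show ?thesis
      unfolding Y_def sum.insert[OF insert.hyps] by blast
  qed
  ultimately show ?case by blast
qed

lemma finite_net_bounded_combinations:
  fixes F :: "'a::real_normed_vector set"
  assumes "finite F" and \<delta>: "\<delta> > 0"
  obtains N where "finite N"
    and "\<And>\<alpha>. \<forall>w\<in>F. \<bar>\<alpha> w\<bar> \<le> R \<Longrightarrow> \<exists>v\<in>N. norm ((\<Sum>w\<in>F. \<alpha> w *\<^sub>R w) - v) \<le> \<delta>"
proof -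
  obtain Z where Z: "compact Z"
      "\<And>\<alpha>. \<forall>w\<in>F. \<bar>\<alpha> w\<bar> \<le> R \<Longrightarrow> (\<Sum>w\<in>F. \<alpha> w *\<^sub>R w) \<in> Z"
    using compact_bounded_combinations[OF assms(1)] by blast
  have "Z \<subseteq> (\<Union>x\<in>Z. ball x \<delta>)" using \<delta> by auto
  then obtain N where N: "finite N" "Z \<subseteq> (\<Union>x\<in>N. ball x \<delta>)"
    by (rule compactE_image[OF Z(1) open_ball]) blast
  show ?thesis
  proof
    fix \<alpha> :: "'a \<Rightarrow> real" assume "\<forall>w\<in>F. \<bar>\<alpha> w\<bar> \<le> R"
    from Z(2)[OF this] N(2) obtain v where "v \<in> N" "(\<Sum>w\<in>F. \<alpha> w *\<^sub>R w) \<in> ball v \<delta>"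
      by blast
    then show "\<exists>v\<in>N. norm ((\<Sum>w\<in>F. \<alpha> w *\<^sub>R w) - v) \<le> \<delta>"
      by (intro bexI[of _ v]) (auto simp: dist_norm norm_minus_commute)
  qed fact
qed

text \<open>By Hahn--Banach it suffices that the demands \<open>\<psi> (comb \<alpha>) \<ge> \<phi>
  (comb \<alpha>) - \<eta> * size1 \<alpha>\<close> and \<open>\<psi> e \<ge> 1\<close> are
  compatible with the norm bound \<open>K'\<close>. For bounded coefficients this holds since
  \<open>e\<close> is almost l1-orthogonal to a net of combinations, for large ones since the
  penalty in \<open>\<eta>\<close> dominates. The set \<open>N\<close> depends neither on
  \<open>e\<close> nor on \<open>\<phi>\<close>.\<close>

lemma functional_perturbation:
  fixes F :: "'a::real_normed_vector set"
  assumes K: "1 \<le> K" "K < K'" and \<eta>: "\<eta> > 0" and F: "finite F"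
  obtains N d where "finite (N :: 'a set)" and "d > 0"
    and "\<And>e \<phi>. norm e = 1 \<Longrightarrow> e \<in> l1_far d N \<Longrightarrow> \<phi> \<in> functional_ball K \<Longrightarrow>
      \<exists>\<psi>\<in>functional_ball K'. (\<forall>w\<in>F. \<bar>\<psi> w - \<phi> w\<bar> \<le> \<eta>) \<and> 1 \<le> \<psi> e"
proof -
  \<comment> \<open>Chosen so that \<open>K' * (1 - 3 * d) = 1\<close>: two of the three errors come
    from the net, one from \<open>l1_far\<close>. Beyond \<open>R\<close> the penalty
    \<open>\<eta> * size1 \<alpha>\<close> is at least \<open>1 + K'\<close>.\<close>
  define d where "d = (1 - 1 / K') / 3"
  define R where "R = (1 + K') / \<eta>"
  have d: "d > 0" using K by (simp add: d_def field_simps)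
  obtain N where N: "finite N"
      "\<And>\<alpha>. \<forall>w\<in>F. \<bar>\<alpha> w\<bar> \<le> R \<Longrightarrow> \<exists>v\<in>N. norm ((\<Sum>w\<in>F. \<alpha> w *\<^sub>R w) - v) \<le> d"
    by (rule finite_net_bounded_combinations[OF F d, where R = R]) (rule that)
  have "\<exists>\<psi>\<in>functional_ball K'. (\<forall>w\<in>F. \<bar>\<psi> w - \<phi> w\<bar> \<le> \<eta>) \<and> 1 \<le> \<psi> e"
    if e: "norm e = 1" "e \<in> l1_far d N" and \<phi>: "\<phi> \<in> functional_ball K" for e \<phi>
  proof -
    define comb where "comb = (\<lambda>\<alpha>. \<Sum>w\<in>F. \<alpha> w *\<^sub>R w)"
    define size1 where "size1 = (\<lambda>\<alpha>. \<Sum>w\<in>F. \<bar>\<alpha> w\<bar> :: real)"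
    have lin: "linear \<phi>" and bound: "\<And>x. \<phi> x \<le> K * norm x"
      using \<phi> by (auto simp: functional_ball_def bounded_linear.linear abs_le_iff)
    have comb_add: "comb (\<lambda>w. \<alpha> w + \<beta> w) = comb \<alpha> + comb \<beta>" for \<alpha> \<beta>
      by (simp add: comb_def scaleR_add_left sum.distrib)
    have comb_scale: "comb (\<lambda>w. t * \<alpha> w) = t *\<^sub>R comb \<alpha>" for t \<alpha>
      by (simp add: comb_def scaleR_sum_right)
    have size1_add: "size1 (\<lambda>w. \<alpha> w + \<beta> w) \<le> size1 \<alpha> + size1 \<beta>" for \<alpha> \<beta>
      unfolding size1_def sum.distrib[symmetric] by (intro sum_mono abs_triangle_ineq)
    have size1_scale: "size1 (\<lambda>w. t * \<alpha> w) = \<bar>t\<bar> * size1 \<alpha>" for t \<alpha>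
      by (simp add: size1_def abs_mult sum_distrib_left)
    have KK: "K * norm v \<le> K' * norm v" for v :: 'a
      using K by (intro mult_right_mono) auto
    \<comment> \<open>The case of coefficient one in front of \<open>e\<close>. The norm bound on
      the cone is reduced to it by dividing through a coefficient \<open>c > 0\<close>.\<close>
    have unit: "\<phi> (comb \<alpha>) - \<eta> * size1 \<alpha> + 1 \<le> K' * norm (comb \<alpha> + e)" for \<alpha>
    proof (cases "size1 \<alpha> \<le> R")
      case True
      have "\<bar>\<alpha> w\<bar> \<le> R" if "w \<in> F" for w
        using member_le_sum[of w F "\<lambda>w. \<bar>\<alpha> w\<bar>"] that F True by (simp add: size1_def)
      then obtain u where u: "u \<in> N" "norm (comb \<alpha> - u) \<le> d"
        using N(2)[of \<alpha>] unfolding comb_def by blast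
      have "norm u + 1 - d \<le> norm (u + e)" using e(2) u(1) by (simp add: l1_far_def)
      moreover have "norm (u + e) \<le> norm (comb \<alpha> + e) + norm (comb \<alpha> - u)"
        using norm_triangle_ineq4[of "comb \<alpha> + e" "comb \<alpha> - u"]
        by (simp add: add.commute)
      moreover have "norm (comb \<alpha>) \<le> norm u + norm (comb \<alpha> - u)"
        using norm_triangle_ineq[of u "comb \<alpha> - u"] by simp
      ultimately have "norm (comb \<alpha>) + 1 - 3 * d \<le> norm (comb \<alpha> + e)"
        using u(2) by linarith
      then have "K' * (norm (comb \<alpha>) + 1 - 3 * d) \<le> K' * norm (comb \<alpha> + e)"
        using K by (intro mult_left_mono) auto
      moreover have "K' * (norm (comb \<alpha>) + 1 - 3 * d) = K' * norm (comb \<alpha>) + 1"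
        using K by (simp add: d_def field_simps)
      moreover have "0 \<le> \<eta> * size1 \<alpha>"
        using \<eta> by (simp add: size1_def sum_nonneg)
      ultimately show ?thesis
        using bound[of "comb \<alpha>"] KK[of "comb \<alpha>"] by linarith
    next
      case False
      then have "1 + K' \<le> \<eta> * size1 \<alpha>"
        using \<eta> by (simp add: R_def field_simps)
      moreover have "norm (comb \<alpha>) \<le> norm (comb \<alpha> + e) + 1"
        using norm_triangle_ineq4[of "comb \<alpha> + e" e] e(1) by simp
      then have "K' * norm (comb \<alpha>) \<le> K' * norm (comb \<alpha> + e) + K'"
        using mult_left_mono[of "norm (comb \<alpha>)" "norm (comb \<alpha> + e) + 1" K'] K
        by (simp add: distrib_left)
      ultimately show ?thesis
        using bound[of "comb \<alpha>"] KK[of "comb \<alpha>"] by linarith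
    qed
    define \<Lambda> where "\<Lambda> = {(x, r). \<exists>\<alpha> c. c \<ge> 0 \<and> x = comb \<alpha> + c *\<^sub>R e \<and>
      r \<le> \<phi> (comb \<alpha>) - \<eta> * size1 \<alpha> + c}"
    have \<Lambda>I: "(comb \<alpha> + c *\<^sub>R e, r) \<in> \<Lambda>"
      if "c \<ge> 0" "r \<le> \<phi> (comb \<alpha>) - \<eta> * size1 \<alpha> + c" for \<alpha> c r
      unfolding \<Lambda>_def using that by blast
    have \<Lambda>E: thesis if "(x, r) \<in> \<Lambda>" and "\<And>\<alpha> c. x = comb \<alpha> + c *\<^sub>R e \<Longrightarrow> c \<ge> 0 \<Longrightarrow>
      r \<le> \<phi> (comb \<alpha>) - \<eta> * size1 \<alpha> + c \<Longrightarrow> thesis" for x r thesis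
      using that unfolding \<Lambda>_def by blast
    obtain \<psi> where \<psi>: "bounded_linear \<psi>" "\<And>x. \<bar>\<psi> x\<bar> \<le> K' * norm x"
        "\<And>x r. (x, r) \<in> \<Lambda> \<Longrightarrow> r \<le> \<psi> x"
    proof (rule hahn_banach_cone[of \<Lambda> K'])
      show "(0, 0) \<in> \<Lambda>"
        using \<Lambda>I[of 0 0 "\<lambda>_. 0"] linear_0[OF lin] by (simp add: comb_def size1_def)
    next
      fix x r y s assume "(x, r) \<in> \<Lambda>" "(y, s) \<in> \<Lambda>"
      then obtain \<alpha> c \<beta> b where *: "x = comb \<alpha> + c *\<^sub>R e" "c \<ge> 0" "y = comb \<beta> + b *\<^sub>R e" "b \<ge> 0"
        "r \<le> \<phi> (comb \<alpha>) - \<eta> * size1 \<alpha> + c" "s \<le> \<phi> (comb \<beta>) - \<eta> * size1 \<beta> + b"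
        by (elim \<Lambda>E) blast
      have "\<eta> * size1 (\<lambda>w. \<alpha> w + \<beta> w) \<le> \<eta> * size1 \<alpha> + \<eta> * size1 \<beta>"
        unfolding distrib_left[symmetric] using \<eta> size1_add by (intro mult_left_mono) auto
      then have "(comb (\<lambda>w. \<alpha> w + \<beta> w) + (c + b) *\<^sub>R e, r + s) \<in> \<Lambda>"
        using * by (intro \<Lambda>I) (auto simp: comb_add linear_add[OF lin])
      then show "(x + y, r + s) \<in> \<Lambda>"
        by (simp add: * comb_add scaleR_add_left add_ac)
    next
      fix t :: real and x r assume t: "t > 0" and "(x, r) \<in> \<Lambda>"
      then obtain \<alpha> c where *: "x = comb \<alpha> + c *\<^sub>R e" "c \<ge> 0" "r \<le> \<phi> (comb \<alpha>) - \<eta> * size1 \<alpha> + c"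
        by (elim \<Lambda>E) blast
      have "t * r \<le> t * (\<phi> (comb \<alpha>) - \<eta> * size1 \<alpha> + c)"
        using * t by (intro mult_left_mono) auto
      then have "(comb (\<lambda>w. t * \<alpha> w) + (t * c) *\<^sub>R e, t * r) \<in> \<Lambda>"
        using * t by (intro \<Lambda>I) (auto simp: comb_scale size1_scale linear_scale[OF lin] algebra_simps)
      then show "(t *\<^sub>R x, t * r) \<in> \<Lambda>"
        by (simp add: * comb_scale scaleR_add_right)
    next
      fix x r assume "(x, r) \<in> \<Lambda>"
      then obtain \<alpha> c where *: "x = comb \<alpha> + c *\<^sub>R e" "c \<ge> 0" "r \<le> \<phi> (comb \<alpha>) - \<eta> * size1 \<alpha> + c"
        by (elim \<Lambda>E) blast
      show "r \<le> K' * norm x"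
      proof (cases "c = 0")
        case True
        have "0 \<le> \<eta> * size1 \<alpha>" using \<eta> by (simp add: size1_def sum_nonneg)
        then show ?thesis using * True bound[of "comb \<alpha>"] KK[of "comb \<alpha>"] by simp
      next
        case False
        then have c: "c > 0" using * by simp
        define \<beta> where "\<beta> = (\<lambda>w. (1 / c) * \<alpha> w)"
        have "\<alpha> = (\<lambda>w. c * \<beta> w)" using c by (simp add: \<beta>_def)
        then have eq: "comb \<alpha> = c *\<^sub>R comb \<beta>" "size1 \<alpha> = c * size1 \<beta>"
          using c by (simp_all add: comb_scale size1_scale)
        have "r \<le> c * (\<phi> (comb \<beta>) - \<eta> * size1 \<beta> + 1)"
          using *(3) by (simp add: eq linear_scale[OF lin] algebra_simps)
        also have "\<dots> \<le> c * (K' * norm (comb \<beta> + e))"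
          using unit[of \<beta>] c by (intro mult_left_mono) auto
        also have "\<dots> = K' * norm (c *\<^sub>R (comb \<beta> + e))"
          using c by simp
        also have "c *\<^sub>R (comb \<beta> + e) = x"
          by (simp add: * eq scaleR_add_right)
        finally show ?thesis .
      qed
    qed (use K in auto)
    have "1 \<le> \<psi> e"
      using \<psi>(3)[OF \<Lambda>I[of 1 1 "\<lambda>_. 0"]] linear_0[OF lin] by (simp add: comb_def size1_def)
    moreover have "\<bar>\<psi> w - \<phi> w\<bar> \<le> \<eta>" if w: "w \<in> F" for w
    proof -
      \<comment> \<open>Coefficients concentrated at \<open>w\<close> with value \<open>1\<close>
        and \<open>-1\<close> turn the one-sided bounds on the cone into the two-sided estimate at
        \<open>w\<close>.\<close>
      have cw: "comb (\<lambda>u. t * of_bool (u = w)) = t *\<^sub>R w"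
        and sw: "size1 (\<lambda>u. t * of_bool (u = w)) = \<bar>t\<bar>" for t
      proof -
        have "comb (\<lambda>u. of_bool (u = w)) = (\<Sum>u\<in>F. if u = w then w else 0)"
          unfolding comb_def by (intro sum.cong) auto
        then show "comb (\<lambda>u. t * of_bool (u = w)) = t *\<^sub>R w"
          using w F by (simp add: comb_scale)
        have "size1 (\<lambda>u. of_bool (u = w)) = (\<Sum>u\<in>F. if u = w then 1 else 0)"
          unfolding size1_def by (intro sum.cong) auto
        then show "size1 (\<lambda>u. t * of_bool (u = w)) = \<bar>t\<bar>"
          using w F by (simp add: size1_scale)
      qed
      have "t * \<phi> w - \<eta> * \<bar>t\<bar> \<le> t * \<psi> w" for t
        using \<psi>(3)[OF \<Lambda>I[of 0 "t * \<phi> w - \<eta> * \<bar>t\<bar>" "\<lambda>u. t * of_bool (u = w)"]]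
        by (simp add: cw sw linear_scale[OF lin] linear_scale[OF bounded_linear.linear[OF \<psi>(1)]])
      from this[of 1] this[of "-1"] show ?thesis by (simp add: abs_le_iff)
    qed
    ultimately show ?thesis
      using \<psi>(1,2) by (intro bexI[of _ \<psi>]) (auto simp: functional_ball_def)
  qed
  with N(1) d show ?thesis by (rule that)
qed

section \<open>Functionals adapted to single slopes and to averages of slopes\<close>

context lipschitz_daugavet
begin

text \<open>The order of quantifiers is the point: one slope pair serves all functionals of the ball
  at once, although the perturbed functional depends on \<open>\<phi>\<close>.\<close>

lemma almost_extension_step:
  fixes g :: "'a \<Rightarrow> real"
  assumes y0: "y0 \<in> closure (convex hull (slope T))" and g: "bounded_linear g" and \<theta>: "\<theta> > 0"
    and K: "1 \<le> K" "K < K'" and \<eta>: "\<eta> > 0" and F: "finite F"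
  obtains e s where "(e, s) \<in> slope_pairs T" and "g y0 - \<theta> < g s"
    and "\<And>\<phi>. \<phi> \<in> functional_ball K \<Longrightarrow>
      \<exists>\<psi>\<in>functional_ball K'. (\<forall>w\<in>F. \<bar>\<psi> w - \<phi> w\<bar> \<le> \<eta>) \<and> 1 \<le> \<psi> e"
proof -
  obtain N d where N: "finite (N :: 'a set)" "d > 0"
    and ext: "\<And>e \<phi>. norm e = 1 \<Longrightarrow> e \<in> l1_far d N \<Longrightarrow> \<phi> \<in> functional_ball K \<Longrightarrow>
      \<exists>\<psi>\<in>functional_ball K'. (\<forall>w\<in>F. \<bar>\<psi> w - \<phi> w\<bar> \<le> \<eta>) \<and> 1 \<le> \<psi> e"
    by (rule functional_perturbation[OF K \<eta> F]) (rule that)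
  obtain e s where es: "(e, s) \<in> slope_pairs T" "e \<in> l1_far d N" "g y0 - \<theta> < g s"
    by (rule slope_pair_in_half_space[OF y0 g \<theta> N])
  show ?thesis
    by (rule that[OF es(1,3) ext[OF norm_fst_slope_pairs[OF es(1)] es(2)]])
qed

text \<open>
  The slopes are picked one after the other so that their running average is pushed towards \<open>y0\<close>
  in the Euclidean seminorm given by \<open>G\<close> (Blackwell's approachability argument); this plays the
  role of Bourgain's lemma on convex combinations of slices.
\<close>

lemma averaging_block:
  fixes y0 :: 'a and G :: "('a \<Rightarrow> real) set"
  assumes y0: "y0 \<in> closure (convex hull (slope T))"
    and K: "1 \<le> K" "K < M" and \<eta>: "\<eta> > 0" and F: "finite F"
    and G: "finite G" "\<And>f. f \<in> G \<Longrightarrow> bounded_linear f"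
    and slope_le: "\<And>s. s \<in> slope T \<Longrightarrow> norm s \<le> lam"
    and gap: "\<And>e s. (e, s) \<in> slope_pairs T \<Longrightarrow> norm (e + s) \<le> D"
    and a: "M * D - 1 < a"
  obtains t K' where "t \<in> convex hull (slope T)" and "\<And>f. f \<in> G \<Longrightarrow> \<bar>f t - f y0\<bar> \<le> \<eta>"
    and "1 \<le> K'" and "K' < M"
    and "\<And>\<phi>. \<phi> \<in> functional_ball K \<Longrightarrow>
      \<exists>\<psi>\<in>functional_ball K'. (\<forall>w\<in>F. \<bar>\<psi> w - \<phi> w\<bar> \<le> \<eta>) \<and> \<psi> t \<le> a"
proof -
  obtain s0 where s0: "s0 \<in> slope T"
    using y0 by fastforce
  define b where "b = (\<lambda>f::'a \<Rightarrow> real. onorm f * lam + \<bar>f y0\<bar>)"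
  have b: "\<bar>f s - f y0\<bar> \<le> b f" if "f \<in> G" "s \<in> slope T" for f s
  proof -
    have "norm (f s) \<le> onorm f * norm s" by (rule onorm[OF G(2)[OF that(1)]])
    also have "\<dots> \<le> onorm f * lam"
      using slope_le[OF that(2)] onorm_pos_le[OF G(2)[OF that(1)]] by (intro mult_left_mono)
    finally show ?thesis by (simp add: b_def)
  qed
  define B where "B = 1 + (\<Sum>f\<in>G. (b f)\<^sup>2)"
  have B: "B \<ge> 1" by (simp add: B_def sum_nonneg)
  obtain m :: nat where m: "real m > B / \<eta>\<^sup>2"
    using reals_Archimedean2 by blast
  have "B / \<eta>\<^sup>2 > 0" using B \<eta> by simp
  with m have "real m > 0" by linarith
  then have m0: "m > 0" by simp
  \<comment> \<open>After \<open>m\<close> steps the accumulated perturbation is at most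
    \<open>\<eta>\<close>. In each step an error \<open>h\<close> in the old part of the sum is paid
    from the slack between \<open>M * D - 1\<close> and \<open>a\<close>.\<close>
  define h where "h = min (\<eta> / m) (a - (M * D - 1))"
  have h: "h > 0" "h * m \<le> \<eta>" "h \<le> a - (M * D - 1)"
  proof -
    show "h > 0" using \<eta> m0 a by (simp add: h_def)
    show "h \<le> a - (M * D - 1)" by (simp add: h_def)
    have "h \<le> \<eta> / m" by (simp add: h_def)
    then show "h * m \<le> \<eta>" using m0 by (simp add: field_simps)
  qed
  \<comment> \<open>With everything multiplied by \<open>n\<close>, the estimates on
    \<open>c\<close> are trivial for \<open>n = 0\<close>. The squared deviation of the sum grows
    only linearly in \<open>n\<close>, so that of the average tends to zero.\<close>
  have "\<exists>c K'. c \<in> convex hull (slope T) \<and> (\<Sum>f\<in>G. (n * f c - n * f y0)\<^sup>2) \<le> n * B \<and>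
      1 \<le> K' \<and> K' < M \<and> (\<forall>\<phi>\<in>functional_ball K. \<exists>\<psi>\<in>functional_ball K'.
        (\<forall>w\<in>F. \<bar>\<psi> w - \<phi> w\<bar> \<le> n * h) \<and> n * \<psi> c \<le> n * a)" for n :: nat
  proof (induction n)
    case 0
    have "s0 \<in> convex hull (slope T)" using s0 by (rule hull_inc)
    then show ?case using K by (intro exI[of _ s0] exI[of _ K]) (auto intro!: bexI)
  next
    case (Suc n)
    then obtain c K' where c: "c \<in> convex hull (slope T)" "(\<Sum>f\<in>G. (n * f c - n * f y0)\<^sup>2) \<le> n * B"
      and K': "1 \<le> K'" "K' < M"
      and ext: "\<And>\<phi>. \<phi> \<in> functional_ball K \<Longrightarrow> \<exists>\<psi>\<in>functional_ball K'.
        (\<forall>w\<in>F. \<bar>\<psi> w - \<phi> w\<bar> \<le> n * h) \<and> n * \<psi> c \<le> n * a"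
      by blast
    define d where "d = (\<lambda>f::'a \<Rightarrow> real. n * f c - n * f y0)"
    \<comment> \<open>Blackwell's choice: the cross term in the new squared deviation equals
      \<open>g y0 - g s\<close>, which the half-space condition keeps below \<open>1 / 2\<close>.
      Its double is covered by the summand \<open>1\<close> in \<open>B\<close>.\<close>
    define g where "g = (\<lambda>x. \<Sum>f\<in>G. - d f * f x)"
    have g: "bounded_linear g"
      unfolding g_def using G(2) by (intro bounded_linear_sum bounded_linear_const_mult)
    obtain L where L: "K' < L" "L < M" using dense[OF K'(2)] by blast
    \<comment> \<open>The partial sum \<open>n *\<^sub>R c\<close> joins the vectors on which the
      functional moves by at most \<open>h\<close>, so the bound on the earlier slopes survives the
      step.\<close>
    have half: "(0::real) < 1 / 2" and fin: "finite (insert (n *\<^sub>R c) F)" using F by simp_all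
    obtain e s where es: "(e, s) \<in> slope_pairs T" "g y0 - 1 / 2 < g s"
      and step: "\<And>\<phi>. \<phi> \<in> functional_ball K' \<Longrightarrow> \<exists>\<psi>\<in>functional_ball L.
        (\<forall>w\<in>insert (n *\<^sub>R c) F. \<bar>\<psi> w - \<phi> w\<bar> \<le> h) \<and> 1 \<le> \<psi> e"
      by (rule almost_extension_step[OF y0 g half K'(1) L(1) h(1) fin]) (rule that)
    have s: "s \<in> slope T" using es(1) by (force simp: slope_eq_image)
    define c' where "c' = (real n / Suc n) *\<^sub>R c + (1 / Suc n) *\<^sub>R s"
    have Sc': "Suc n *\<^sub>R c' = n *\<^sub>R c + s"
      by (simp add: c'_def scaleR_add_right del: of_nat_Suc)
    have hom: "Suc n * f c' = n * f c + f s" if "bounded_linear f" for f :: "'a \<Rightarrow> real"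
    proof -
      have lin: "linear f" by (rule bounded_linear.linear[OF that])
      have "f (Suc n *\<^sub>R c') = f (n *\<^sub>R c + s)" by (simp only: Sc')
      then show ?thesis by (simp only: linear_scale[OF lin] linear_add[OF lin] real_scaleR_def)
    qed
    have "c' \<in> convex hull (slope T)"
      unfolding c'_def using c(1) hull_inc[OF s]
      by (intro convexD[OF convex_convex_hull]) (auto simp: field_simps)
    moreover have "(\<Sum>f\<in>G. (Suc n * f c' - Suc n * f y0)\<^sup>2) \<le> Suc n * B"
    proof -
      have "(\<Sum>f\<in>G. (Suc n * f c' - Suc n * f y0)\<^sup>2) =
          (\<Sum>f\<in>G. (d f)\<^sup>2 + 2 * (d f * (f s - f y0)) + (f s - f y0)\<^sup>2)"
      proof (rule sum.cong[OF refl])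
        fix f assume "f \<in> G"
        then have "Suc n * f c' - Suc n * f y0 = d f + (f s - f y0)"
          using hom[OF G(2)[OF \<open>f \<in> G\<close>]] by (simp add: d_def algebra_simps)
        then show "(Suc n * f c' - Suc n * f y0)\<^sup>2 = (d f)\<^sup>2 + 2 * (d f * (f s - f y0)) + (f s - f y0)\<^sup>2"
          by (simp add: power2_sum)
      qed
      also have "\<dots> = (\<Sum>f\<in>G. (d f)\<^sup>2) + 2 * (\<Sum>f\<in>G. d f * (f s - f y0)) + (\<Sum>f\<in>G. (f s - f y0)\<^sup>2)"
        by (simp add: sum.distrib sum_distrib_left)
      also have "(\<Sum>f\<in>G. d f * (f s - f y0)) = g y0 - g s"
        by (simp add: g_def right_diff_distrib sum_subtractf sum_negf)
      also have "(\<Sum>f\<in>G. (f s - f y0)\<^sup>2) \<le> (\<Sum>f\<in>G. (b f)\<^sup>2)"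
        using b[OF _ s] by (intro sum_mono) (metis abs_ge_zero power2_abs power_mono)
      finally have "(\<Sum>f\<in>G. (Suc n * f c' - Suc n * f y0)\<^sup>2) \<le> n * B + 2 * (g y0 - g s) + (B - 1)"
        using c(2) by (simp add: d_def B_def)
      then show ?thesis using es(2) by (simp add: algebra_simps)
    qed
    moreover have "\<exists>\<psi>\<in>functional_ball L. (\<forall>w\<in>F. \<bar>\<psi> w - \<phi> w\<bar> \<le> Suc n * h) \<and> Suc n * \<psi> c' \<le> Suc n * a"
      if \<phi>: "\<phi> \<in> functional_ball K" for \<phi>
    proof -
      obtain \<psi> :: "'a \<Rightarrow> real" where \<psi>: "\<psi> \<in> functional_ball K'" "\<And>w. w \<in> F \<Longrightarrow> \<bar>\<psi> w - \<phi> w\<bar> \<le> n * h" "n * \<psi> c \<le> n * a"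
        using ext[OF \<phi>] by blast
      obtain \<xi> :: "'a \<Rightarrow> real" where \<xi>: "\<xi> \<in> functional_ball L" "\<And>w. w \<in> insert (n *\<^sub>R c) F \<Longrightarrow> \<bar>\<xi> w - \<psi> w\<bar> \<le> h" "1 \<le> \<xi> e"
        using step[OF \<psi>(1)] by blast
      have bl: "bounded_linear \<xi>" "bounded_linear \<psi>" and \<xi>le: "\<And>x. \<bar>\<xi> x\<bar> \<le> L * norm x"
        using \<xi>(1) \<psi>(1) by (auto simp: functional_ball_def)
      \<comment> \<open>The failure of the Daugavet equation enters here:
        \<open>\<xi> e \<ge> 1\<close> and the bound on \<open>norm (e + s)\<close> leave at most
        \<open>M * D - 1\<close> for \<open>\<xi> s\<close>.\<close>
      have "\<xi> e + \<xi> s \<le> L * norm (e + s)"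
        using \<xi>le[of "e + s"] linear_add[OF bounded_linear.linear[OF bl(1)]] by simp
      also have "\<dots> \<le> M * D"
        using gap[OF es(1)] L K' by (intro mult_mono) auto
      finally have "\<xi> s \<le> M * D - 1" using \<xi>(3) by simp
      moreover have "n * \<xi> c \<le> n * \<psi> c + h"
        using \<xi>(2)[of "n *\<^sub>R c"] linear_scale[OF bounded_linear.linear[OF bl(1)], of n c]
          linear_scale[OF bounded_linear.linear[OF bl(2)], of n c] by simp
      ultimately have "Suc n * \<xi> c' \<le> Suc n * a"
        using \<psi>(3) h(3) hom[OF bl(1)] by (simp add: algebra_simps)
      moreover have "\<bar>\<xi> w - \<phi> w\<bar> \<le> Suc n * h" if "w \<in> F" for w
        using \<psi>(2)[OF that] \<xi>(2)[of w] that by (simp add: algebra_simps)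
      ultimately show ?thesis using \<xi>(1) by blast
    qed
    ultimately show ?case using L K' by (intro exI[of _ c'] exI[of _ L]) auto
  qed
  from this[of m] obtain c K' where c: "c \<in> convex hull (slope T)"
      "(\<Sum>f\<in>G. (m * f c - m * f y0)\<^sup>2) \<le> m * B"
    and K': "1 \<le> K'" "K' < M"
    and ext: "\<And>\<phi>. \<phi> \<in> functional_ball K \<Longrightarrow> \<exists>\<psi>\<in>functional_ball K'.
        (\<forall>w\<in>F. \<bar>\<psi> w - \<phi> w\<bar> \<le> m * h) \<and> m * \<psi> c \<le> m * a"
    by blast
  show ?thesis
  proof (rule that[OF c(1) _ K'])
    fix f assume f: "f \<in> G"
    have "(m * (f c - f y0))\<^sup>2 \<le> m * B"
      using member_le_sum[OF f, of "\<lambda>f. (m * f c - m * f y0)\<^sup>2"] G(1) c(2)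
      by (simp add: right_diff_distrib)
    also have "B \<le> m * \<eta>\<^sup>2" using m \<eta> by (simp add: field_simps)
    then have "m * B \<le> (m * \<eta>)\<^sup>2" using m0 by (simp add: power2_eq_square algebra_simps)
    finally have "(m * \<bar>f c - f y0\<bar>)\<^sup>2 \<le> (m * \<eta>)\<^sup>2" by (simp add: power_mult_distrib)
    then have "m * \<bar>f c - f y0\<bar> \<le> m * \<eta>"
      by (rule power2_le_imp_le) (use \<eta> in simp)
    then show "\<bar>f c - f y0\<bar> \<le> \<eta>" using m0 by simp
  next
    fix \<phi> :: "'a \<Rightarrow> real" assume "\<phi> \<in> functional_ball K"
    from ext[OF this] obtain \<psi> :: "'a \<Rightarrow> real" where \<psi>: "\<psi> \<in> functional_ball K'"
        "\<And>w. w \<in> F \<Longrightarrow> \<bar>\<psi> w - \<phi> w\<bar> \<le> m * h" "m * \<psi> c \<le> m * a"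
      by blast
    have "\<psi> c \<le> a" using \<psi>(3) m0 by simp
    moreover have "\<bar>\<psi> w - \<phi> w\<bar> \<le> \<eta>" if "w \<in> F" for w
      using \<psi>(2)[OF that] h(2) by (simp add: mult.commute)
    ultimately show "\<exists>\<psi>\<in>functional_ball K'. (\<forall>w\<in>F. \<bar>\<psi> w - \<phi> w\<bar> \<le> \<eta>) \<and> \<psi> c \<le> a"
      using \<psi>(1) by blast
  qed
qed

end

section \<open>Failure of the Daugavet equation\<close>

text \<open>In the application \<open>lam\<close> is the Lipschitz seminorm of \<open>T\<close> and
  \<open>\<epsilon>\<close> the amount missing in the Daugavet equation. The first two assumptions
  make \<open>lam\<close> the supremum of the norms of slopes, the third bounds the slopes of the
  sum with the identity.\<close>

locale daugavet_gap = lipschitz_daugavet T for T :: "'a::real_normed_vector \<Rightarrow> 'a" +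
  fixes lam \<epsilon> :: real
  assumes slope_le: "\<And>s. s \<in> slope T \<Longrightarrow> norm s \<le> lam"
    and slope_near: "\<And>\<delta>. \<delta> > 0 \<Longrightarrow> \<exists>s\<in>slope T. norm s > lam - \<delta>"
    and gap: "\<And>e s. (e, s) \<in> slope_pairs T \<Longrightarrow> norm (e + s) \<le> 1 + lam - \<epsilon>"
    and \<epsilon>_pos: "\<epsilon> > 0"
begin

definition C :: "'a set" where "C = closure (convex hull (slope T))"

text \<open>The room left for the norms of functionals: if \<open>\<psi>\<close> is bounded by
  \<open>M\<close> and \<open>\<psi> e \<ge> 1\<close>, the gap still gives
  \<open>\<psi> s < lam - \<epsilon> / 2\<close>.\<close>

definition M :: real where "M = 1 + \<epsilon> / (4 * (1 + lam))"

lemma lam_nonneg: "lam \<ge> 0"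
proof -
  obtain s where "s \<in> slope T" using slope_near[of 1] by auto
  from slope_le[OF this] show ?thesis using norm_ge_zero[of s] by linarith
qed

lemma \<epsilon>_le: "\<epsilon> \<le> 1 + lam"
proof -
  obtain s where "s \<in> slope T" using slope_near[of 1] by auto
  then obtain e where "(e, s) \<in> slope_pairs T" unfolding slope_eq_image by force
  from gap[OF this] norm_ge_zero[of "e + s"] show ?thesis by linarith
qed

lemma M_bounds: "1 < M" "M \<le> 2" "M * (1 + lam - \<epsilon>) - 1 < lam - \<epsilon> / 2"
proof -
  have pos: "4 * (1 + lam) > 0" using lam_nonneg by simp
  show "1 < M" using pos \<epsilon>_pos by (simp add: M_def)
  have "\<epsilon> / (4 * (1 + lam)) \<le> 1" using pos \<epsilon>_le lam_nonneg by (simp add: pos_divide_le_eq)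
  then show "M \<le> 2" by (simp add: M_def)
  define u where "u = \<epsilon> / (4 * (1 + lam))"
  have "u * (1 + lam) = \<epsilon> / 4" using pos by (simp add: u_def field_simps)
  moreover have "0 \<le> u * \<epsilon>" using pos \<epsilon>_pos by (simp add: u_def)
  moreover have "M = 1 + u" by (simp add: M_def u_def)
  ultimately have "M * (1 + lam - \<epsilon>) - 1 \<le> lam - \<epsilon> + \<epsilon> / 4"
    by (simp add: algebra_simps)
  then show "M * (1 + lam - \<epsilon>) - 1 < lam - \<epsilon> / 2" using \<epsilon>_pos by simp
qed

lemma hull_subset_C: "convex hull (slope T) \<subseteq> C"
  unfolding C_def by (rule closure_subset)

lemma slope_subset_C: "slope T \<subseteq> C"
  by (rule order_trans[OF hull_subset hull_subset_C])

lemma convex_C: "convex C" and closed_C: "closed C"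
  unfolding C_def by (simp_all add: convex_closure)

lemma norm_C_le: "x \<in> C \<Longrightarrow> norm x \<le> lam"
proof -
  have "slope T \<subseteq> cball 0 lam" using slope_le by auto
  then have "C \<subseteq> cball 0 lam"
    unfolding C_def by (intro closure_minimal hull_minimal) auto
  then show "x \<in> C \<Longrightarrow> norm x \<le> lam" by auto
qed

section \<open>Points weakly close to a given point of \<open>C\<close> but separated from it in
  norm\<close>

lemma gap_block:
  fixes y0 :: 'a and G :: "('a \<Rightarrow> real) set"
  assumes "y0 \<in> C" and "1 \<le> K" "K < M" and "\<eta> > 0" and "finite F"
    and "finite G" "\<And>f. f \<in> G \<Longrightarrow> bounded_linear f"
  obtains t K' where "t \<in> convex hull (slope T)" and "\<And>f. f \<in> G \<Longrightarrow> \<bar>f t - f y0\<bar> \<le> \<eta>"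
    and "1 \<le> K'" and "K' < M"
    and "\<And>\<phi>. \<phi> \<in> functional_ball K \<Longrightarrow>
      \<exists>\<psi>\<in>functional_ball K'. (\<forall>w\<in>F. \<bar>\<psi> w - \<phi> w\<bar> \<le> \<eta>) \<and> \<psi> t \<le> lam - \<epsilon> / 2"
  by (rule averaging_block[OF assms(1)[unfolded C_def] assms(2-7) slope_le gap M_bounds(3)])
    (assumption | rule that)+

text \<open>Perturbing a norming functional of \<open>y0\<close> gives \<open>\<psi>\<close> with
  \<open>\<psi> y0 \<ge> lam - 3 * \<epsilon> / 16\<close> and
  \<open>\<psi> t \<le> lam - \<epsilon> / 2\<close> for some \<open>t\<close> in the neighbourhood.
  Since \<open>\<psi>\<close> is bounded by \<open>2\<close>, a distance of at most
  \<open>\<epsilon> / 16\<close> is impossible.\<close>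

lemma no_small_weak_neighbourhood_hull:
  fixes y0 :: 'a and G :: "('a \<Rightarrow> real) set"
  assumes y0: "y0 \<in> C" "norm y0 \<ge> lam - \<epsilon> / 8"
    and G: "finite G" "\<And>f. f \<in> G \<Longrightarrow> bounded_linear f" and \<eta>: "\<eta> > 0"
    and small: "\<And>t. t \<in> C \<Longrightarrow> \<forall>f\<in>G. \<bar>f t - f y0\<bar> \<le> \<eta> \<Longrightarrow> norm (t - y0) \<le> \<epsilon> / 16"
  shows False
proof -
  obtain \<phi> :: "'a \<Rightarrow> real" where \<phi>: "bounded_linear \<phi>" "\<And>x. \<bar>\<phi> x\<bar> \<le> norm x" "\<phi> y0 = norm y0"
    by (rule norming_functional[of y0]) (rule that)
  then have \<phi>1: "\<phi> \<in> functional_ball 1" by (simp add: functional_ball_def)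
  have min: "min \<eta> (\<epsilon> / 16) > 0" using \<eta> \<epsilon>_pos by simp
  have fin: "finite {y0}" by simp
  obtain t K' where t: "t \<in> convex hull (slope T)"
      "\<And>f. f \<in> G \<Longrightarrow> \<bar>f t - f y0\<bar> \<le> min \<eta> (\<epsilon> / 16)" and K': "1 \<le> K'" "K' < M"
    and ext: "\<And>\<phi>. \<phi> \<in> functional_ball 1 \<Longrightarrow> \<exists>\<psi>\<in>functional_ball K'.
      (\<forall>w\<in>{y0}. \<bar>\<psi> w - \<phi> w\<bar> \<le> min \<eta> (\<epsilon> / 16)) \<and> \<psi> t \<le> lam - \<epsilon> / 2"
    by (rule gap_block[OF y0(1) order_refl M_bounds(1) min fin G]) (assumption | rule that)+
  have close: "norm (t - y0) \<le> \<epsilon> / 16"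
    using t hull_subset_C by (intro small) auto
  obtain \<psi> :: "'a \<Rightarrow> real" where \<psi>: "\<psi> \<in> functional_ball K'" "\<bar>\<psi> y0 - \<phi> y0\<bar> \<le> \<epsilon> / 16" "\<psi> t \<le> lam - \<epsilon> / 2"
    using ext[OF \<phi>1] by auto
  have "\<psi> y0 - \<psi> t \<le> K' * norm (y0 - t)"
    using \<psi>(1) linear_diff[OF bounded_linear.linear, of \<psi> y0 t]
    by (auto simp: functional_ball_def dest: spec[of _ "y0 - t"])
  also have "\<dots> \<le> 2 * (\<epsilon> / 16)"
    using K' M_bounds(2) close by (intro mult_mono) (auto simp: norm_minus_commute)
  finally show False
    using \<psi>(2,3) \<phi>(3) y0(2) \<epsilon>_pos by linarith
qed

text \<open>A weak neighbourhood of \<open>x\<close> relative to the slab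
  \<open>\<phi> \<ge> lam - \<epsilon> / 8\<close> need not be one relative to \<open>C\<close>,
  since \<open>x\<close> may lie on the boundary of the slab. Moving \<open>x\<close> slightly
  towards \<open>s0\<close> gives a \<open>y0\<close> strictly inside, for which a small weak
  neighbourhood in \<open>C\<close> stays in the slab and near \<open>x\<close>.\<close>

lemma no_weak_norm_point:
  fixes \<phi> :: "'a \<Rightarrow> real" and G :: "('a \<Rightarrow> real) set"
  assumes \<phi>: "\<phi> \<in> functional_ball 1"
    and s0: "s0 \<in> slope T" "\<phi> s0 > lam - \<epsilon> / 16"
    and x: "x \<in> C" "\<phi> x \<ge> lam - \<epsilon> / 8"
    and G: "finite G" "\<And>f. f \<in> G \<Longrightarrow> bounded_linear f" and \<eta>: "\<eta> > 0"
    and small: "\<And>t. t \<in> C \<Longrightarrow> \<phi> t \<ge> lam - \<epsilon> / 8 \<Longrightarrow> \<forall>f\<in>G. \<bar>f t - f x\<bar> < \<eta> \<Longrightarrow>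
      norm (t - x) \<le> \<epsilon> / 32"
  shows False
proof -
  define Q where "Q = 1 + norm (s0 - x) + (\<Sum>f\<in>G. \<bar>f s0 - f x\<bar>)"
  have sum0: "0 \<le> (\<Sum>f\<in>G. \<bar>f s0 - f x\<bar>)" by (simp add: sum_nonneg)
  then have Q: "Q \<ge> 1" "norm (s0 - x) \<le> Q" unfolding Q_def by simp_all
  have Qf: "\<bar>f s0 - f x\<bar> \<le> Q" if "f \<in> G" for f
  proof -
    have "\<bar>f s0 - f x\<bar> \<le> (\<Sum>f\<in>G. \<bar>f s0 - f x\<bar>)"
      using member_le_sum[OF that, of "\<lambda>f. \<bar>f s0 - f x\<bar>"] G(1) by simp
    then show ?thesis unfolding Q_def using norm_ge_zero[of "s0 - x"] by linarith
  qed
  \<comment> \<open>The shift from \<open>x\<close> to \<open>y0\<close> changes the values of all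
    \<open>f \<in> G\<close> by at most \<open>\<eta> / 2\<close> and the norm by at most
    \<open>\<epsilon> / 32\<close>; the bound \<open>1\<close> keeps \<open>y0\<close> on the
    segment.\<close>
  define \<tau> where "\<tau> = min 1 (min (\<eta> / 2) (\<epsilon> / 32) / Q)"
  have \<tau>: "\<tau> > 0" "\<tau> \<le> 1" unfolding \<tau>_def using Q \<eta> \<epsilon>_pos by simp_all
  have "\<tau> \<le> min (\<eta> / 2) (\<epsilon> / 32) / Q" by (simp add: \<tau>_def)
  then have "\<tau> * Q \<le> min (\<eta> / 2) (\<epsilon> / 32)" using Q by (simp add: pos_le_divide_eq)
  then have \<tau>Q: "\<tau> * Q \<le> \<eta> / 2" "\<tau> * Q \<le> \<epsilon> / 32" by simp_all
  define y0 where "y0 = (1 - \<tau>) *\<^sub>R x + \<tau> *\<^sub>R s0"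
  have y0C: "y0 \<in> C"
    unfolding y0_def using x(1) s0(1) slope_subset_C \<tau> by (intro convexD[OF convex_C]) auto
  have y0x: "y0 - x = \<tau> *\<^sub>R (s0 - x)" by (simp add: y0_def algebra_simps)
  have fy0: "f y0 - f x = \<tau> * (f s0 - f x)" if "bounded_linear f" for f :: "'a \<Rightarrow> real"
  proof -
    have lin: "linear f" by (rule bounded_linear.linear[OF that])
    have "f (y0 - x) = f (\<tau> *\<^sub>R (s0 - x))" by (simp only: y0x)
    then show ?thesis by (simp only: linear_diff[OF lin] linear_scale[OF lin] real_scaleR_def)
  qed
  have \<phi>bl: "bounded_linear \<phi>" and \<phi>le: "\<And>x. \<bar>\<phi> x\<bar> \<le> norm x"
    using \<phi> by (auto simp: functional_ball_def)
  have "\<phi> y0 = (1 - \<tau>) * \<phi> x + \<tau> * \<phi> s0" using fy0[OF \<phi>bl] by (simp add: algebra_simps)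
  moreover have "(1 - \<tau>) * \<phi> x \<ge> (1 - \<tau>) * (lam - \<epsilon> / 8)" "\<tau> * \<phi> s0 \<ge> \<tau> * (lam - \<epsilon> / 16)"
    using x(2) s0(2) \<tau> by (auto intro!: mult_left_mono)
  ultimately have \<phi>y0: "\<phi> y0 \<ge> lam - \<epsilon> / 8 + \<tau> * (\<epsilon> / 16)"
    by (simp add: algebra_simps diff_divide_distrib)
  have \<tau>\<epsilon>: "\<tau> * (\<epsilon> / 16) > 0" using \<tau> \<epsilon>_pos by simp
  have norm_y0: "norm y0 \<ge> lam - \<epsilon> / 8" using \<phi>y0 \<tau>\<epsilon> \<phi>le[of y0] by linarith
  have min_pos: "min (\<eta> / 4) (\<tau> * (\<epsilon> / 16)) > 0" using \<eta> \<tau>\<epsilon> by simp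
  have fin: "finite (insert \<phi> G)" using G by simp
  show False
  proof (rule no_small_weak_neighbourhood_hull[OF y0C norm_y0 fin _ min_pos])
    show "bounded_linear f" if "f \<in> insert \<phi> G" for f using that G(2) \<phi>bl by blast
  next
    fix t assume t: "t \<in> C" "\<forall>f\<in>insert \<phi> G. \<bar>f t - f y0\<bar> \<le> min (\<eta> / 4) (\<tau> * (\<epsilon> / 16))"
    then have "\<bar>\<phi> t - \<phi> y0\<bar> \<le> \<tau> * (\<epsilon> / 16)" by simp
    then have "\<phi> t \<ge> lam - \<epsilon> / 8" using \<phi>y0 by linarith
    moreover have "\<bar>f t - f x\<bar> < \<eta>" if "f \<in> G" for f
    proof -
      have "\<bar>f y0 - f x\<bar> \<le> \<tau> * Q"
        using fy0[OF G(2)[OF that]] Qf[OF that] \<tau> by (simp add: abs_mult)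
      moreover have "\<bar>f t - f y0\<bar> \<le> \<eta> / 4" using t(2) that by auto
      ultimately show ?thesis using \<tau>Q(1) \<eta> by linarith
    qed
    ultimately have "norm (t - x) \<le> \<epsilon> / 32" using t(1) by (intro small) auto
    moreover have "norm (y0 - x) \<le> \<tau> * Q" using y0x Q(2) \<tau> by simp
    ultimately show "norm (t - y0) \<le> \<epsilon> / 16"
      using \<tau>Q(2) norm_triangle_ineq4[of "t - x" "y0 - x"] by simp
  qed
qed

section \<open>A slab of \<open>C\<close> as test set for the Radon--Nikodym property and
  CPCP\<close>

lemma near_slope_functional:
  assumes "\<delta> > 0"
  obtains \<phi> :: "'a \<Rightarrow> real" and s0 where "\<phi> \<in> functional_ball 1" and "s0 \<in> slope T" and "\<phi> s0 > lam - \<delta>"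
proof -
  obtain s0 where s0: "s0 \<in> slope T" "norm s0 > lam - \<delta>" using slope_near[OF assms] by blast
  obtain \<phi> :: "'a \<Rightarrow> real" where "bounded_linear \<phi>" "\<And>x. \<bar>\<phi> x\<bar> \<le> norm x" "\<phi> s0 = norm s0"
    by (rule norming_functional[of s0]) (rule that)
  with s0 show ?thesis by (intro that[of \<phi> s0]) (auto simp: functional_ball_def)
qed

text \<open>Both properties only promise a good slice or point somewhere in a closed convex subset.
  In this slab every point has norm at least \<open>lam - \<epsilon> / 8\<close>, so wherever it
  lies, the previous lemmas apply.\<close>

lemma weak_slab:
  assumes "\<phi> \<in> functional_ball 1" and "s0 \<in> slope T" and "\<phi> s0 > lam - \<epsilon> / 16"
  defines "D \<equiv> {x \<in> C. \<phi> x \<ge> lam - \<epsilon> / 8}"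
  shows "D \<subseteq> C" and "D \<noteq> {}" and "closed D" and "convex D" and "bounded D"
proof -
  have bl: "bounded_linear \<phi>" using assms(1) by (simp add: functional_ball_def)
  show "D \<subseteq> C" by (auto simp: D_def)
  have "s0 \<in> D" using assms(2,3) slope_subset_C \<epsilon>_pos by (auto simp: D_def)
  then show "D \<noteq> {}" by blast
  have D: "D = C \<inter> {x. lam - \<epsilon> / 8 \<le> \<phi> x}" by (auto simp: D_def)
  show "closed D" unfolding D
    by (intro closed_Int closed_C closed_Collect_le continuous_on_const linear_continuous_on bl)
  have "convex {x. lam - \<epsilon> / 8 \<le> \<phi> x}"
  proof -
    have "{x. lam - \<epsilon> / 8 \<le> \<phi> x} = \<phi> -` {lam - \<epsilon> / 8..}" by auto
    then show ?thesis using convex_linear_vimage[OF bounded_linear.linear[OF bl]] by simp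
  qed
  then show "convex D" unfolding D by (intro convex_Int convex_C)
  show "bounded D" unfolding bounded_iff using norm_C_le by (auto simp: D_def)
qed

text \<open>A slice contains, around each of its points \<open>x\<close>, the weak neighbourhood in
  the slab given by \<open>f\<close> and the radius \<open>f x - \<alpha>\<close>. A slice of small
  diameter is therefore excluded by \<open>no_weak_norm_point\<close>.\<close>

lemma not_radon_nikodym: "\<not> radon_nikodym_property C"
proof
  assume rnp: "radon_nikodym_property C"
  have pos: "\<epsilon> / 16 > 0" "\<epsilon> / 32 > 0" using \<epsilon>_pos by simp_all
  obtain \<phi> :: "'a \<Rightarrow> real" and s0 where \<phi>: "\<phi> \<in> functional_ball 1" "s0 \<in> slope T" "\<phi> s0 > lam - \<epsilon> / 16"
    by (rule near_slope_functional[OF pos(1)]) (rule that)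
  define D where "D = {x \<in> C. \<phi> x \<ge> lam - \<epsilon> / 8}"
  note D = weak_slab[OF \<phi>, folded D_def]
  have "dentable D" using rnp D by (auto simp: radon_nikodym_property_def)
  then obtain S where S: "is_slice D S" "diameter S < \<epsilon> / 32"
    unfolding dentable_def using pos(2) by blast
  then obtain f :: "'a \<Rightarrow> real" and \<alpha> x where f: "bounded_linear f" "S = D \<inter> {x. \<alpha> < f x}" "x \<in> S"
    unfolding is_slice_def by auto
  have "bounded S" using D(5) f(2) by (auto intro: bounded_subset)
  show False
  proof (rule no_weak_norm_point[OF \<phi>, of x "{f}" "f x - \<alpha>"])
    show "x \<in> C" "\<phi> x \<ge> lam - \<epsilon> / 8" "f x - \<alpha> > 0" using f by (auto simp: D_def)
    fix t assume "t \<in> C" "\<phi> t \<ge> lam - \<epsilon> / 8" "\<forall>g\<in>{f}. \<bar>g t - g x\<bar> < f x - \<alpha>"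
    then have "t \<in> S" using f by (auto simp: D_def)
    then have "dist t x \<le> diameter S" using \<open>bounded S\<close> f(3) by (intro diameter_bounded_bound)
    then show "norm (t - x) \<le> \<epsilon> / 32" using S(2) by (simp add: dist_norm)
  qed (use f in auto)
qed

end

section \<open>Independence and \<open>\<ell>\<^sub>1\<close>-sequences\<close>

locale gap_scalars = daugavet_gap T lam \<epsilon> + scalar_structure sc re
  for T :: "'a::real_normed_vector \<Rightarrow> 'a" and lam \<epsilon> :: real
    and sc :: "'k::{real_normed_field, euclidean_space} \<Rightarrow> 'a \<Rightarrow> 'a" and re :: "'k \<Rightarrow> real"
begin

text \<open>
  A choice pattern \<open>\<sigma>\<close> is realised by a functional that is below the gap on \<open>t i\<close> for \<open>i \<in> \<sigma>\<close> and sees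
  \<open>t i\<close> as \<open>\<phi>0\<close> sees \<open>y0\<close> for \<open>i \<notin> \<sigma>\<close>. The multiples \<open>sc b\<close> with \<open>b \<in> Basis\<close> are needed to control complex
  coefficients by real functionals.
\<close>

definition realises :: "('a \<Rightarrow> real) \<Rightarrow> 'a \<Rightarrow> real \<Rightarrow> nat \<Rightarrow> (nat \<Rightarrow> 'a) \<Rightarrow> nat set \<Rightarrow> ('a \<Rightarrow> real) \<Rightarrow> bool" where
  "realises \<phi>0 y0 r n t \<sigma> \<phi> \<longleftrightarrow>
     (\<forall>b\<in>Basis. \<bar>\<phi> (sc b y0) - \<phi>0 (sc b y0)\<bar> \<le> r) \<and>
     (\<forall>i<n. if i \<in> \<sigma> then \<phi> (t i) \<le> lam - \<epsilon> / 2 + r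
       else \<forall>b\<in>Basis. \<bar>\<phi> (sc b (t i)) - \<phi>0 (sc b y0)\<bar> \<le> r)"

text \<open>The bound \<open>K\<close> is common to all patterns and strictly below
  \<open>M\<close>, which leaves room for the next block.\<close>

definition independent_upto :: "('a \<Rightarrow> real) \<Rightarrow> 'a \<Rightarrow> real \<Rightarrow> nat \<Rightarrow> (nat \<Rightarrow> 'a) \<Rightarrow> bool" where
  "independent_upto \<phi>0 y0 r n t \<longleftrightarrow>
     (\<forall>i<n. t i \<in> convex hull (slope T)) \<and>
     (\<exists>K\<ge>1. K < M \<and> (\<forall>\<sigma>. \<exists>\<phi>\<in>functional_ball K. realises \<phi>0 y0 r n t \<sigma> \<phi>))"

lemma realises_cong:
  assumes "\<And>i. i < n \<Longrightarrow> t i = t' i" and "\<sigma> \<inter> {..<n} = \<sigma>' \<inter> {..<n}"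
  shows "realises \<phi>0 y0 r n t \<sigma> \<phi> \<longleftrightarrow> realises \<phi>0 y0 r n t' \<sigma>' \<phi>"
proof -
  have "i \<in> \<sigma> \<longleftrightarrow> i \<in> \<sigma>'" if "i < n" for i using assms(2) that by blast
  then show ?thesis unfolding realises_def using assms(1) by (simp cong: conj_cong)
qed

text \<open>The new point is weakly close to \<open>y0\<close> for all functionals chosen so far, so
  a pattern without \<open>n\<close> keeps its functional. For a pattern containing \<open>n\<close>
  the functional is perturbed to fall below the gap at the new point, and the set \<open>F\<close>
  of all vectors occurring in \<open>realises\<close> preserves what was achieved before.\<close>

lemma independent_upto_step:
  assumes ind: "independent_upto \<phi>0 y0 r n t" and y0: "y0 \<in> C" and h: "h > 0" "r \<ge> 0"
  shows "\<exists>x. independent_upto \<phi>0 y0 (r + h) (Suc n) (t(n := x))"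
proof -
  obtain K where K: "1 \<le> K" "K < M" and tn: "\<And>i. i < n \<Longrightarrow> t i \<in> convex hull (slope T)"
    and "\<forall>\<sigma>. \<exists>\<phi>\<in>functional_ball K. realises \<phi>0 y0 r n t \<sigma> \<phi>"
    using ind unfolding independent_upto_def by blast
  then obtain \<Psi> where \<Psi>: "\<And>\<sigma>. \<Psi> \<sigma> \<in> functional_ball K" "\<And>\<sigma>. realises \<phi>0 y0 r n t \<sigma> (\<Psi> \<sigma>)"
    by metis
  \<comment> \<open>Only the trace of a pattern on \<open>{..<n}\<close> matters, so finitely many
    functionals represent all patterns and \<open>G\<close> is finite.\<close>
  define G where "G = (\<lambda>(\<sigma>, b) x. \<Psi> \<sigma> (sc b x)) ` (Pow {..<n} \<times> Basis)"
  define F where "F = (\<lambda>b. sc b y0) ` Basis \<union> t ` {..<n} \<union> (\<lambda>(i, b). sc b (t i)) ` ({..<n} \<times> Basis)"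
  have F: "finite F" and G: "finite G" by (simp_all add: F_def G_def)
  have Gbl: "bounded_linear f" if f: "f \<in> G" for f
  proof -
    obtain \<sigma> b where "f = (\<lambda>x. \<Psi> \<sigma> (sc b x))" using f by (auto simp: G_def)
    moreover have "bounded_linear (\<Psi> \<sigma>)" using \<Psi>(1)[of \<sigma>] by (simp add: functional_ball_def)
    ultimately show ?thesis using bounded_linear_compose[OF _ bounded_linear_sc_right] by simp
  qed
  obtain x K' where x: "x \<in> convex hull (slope T)" "\<And>f. f \<in> G \<Longrightarrow> \<bar>f x - f y0\<bar> \<le> h"
    and K': "1 \<le> K'" "K' < M"
    and ext: "\<And>\<phi>. \<phi> \<in> functional_ball K \<Longrightarrow>
      \<exists>\<psi>\<in>functional_ball K'. (\<forall>w\<in>F. \<bar>\<psi> w - \<phi> w\<bar> \<le> h) \<and> \<psi> x \<le> lam - \<epsilon> / 2"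
    by (rule gap_block[OF y0 K h(1) F G Gbl]) (assumption | rule that)+
  define L where "L = max K K'"
  have L: "1 \<le> L" "L < M" using K K' by (auto simp: L_def)
  have ball_L: "functional_ball K \<subseteq> functional_ball L" "functional_ball K' \<subseteq> functional_ball L"
    by (auto intro!: functional_ball_mono simp: L_def)
  have "\<exists>\<phi>\<in>functional_ball L. realises \<phi>0 y0 (r + h) (Suc n) (t(n := x)) \<sigma> \<phi>" for \<sigma>
  proof -
    define \<phi> where "\<phi> = \<Psi> (\<sigma> \<inter> {..<n})"
    have \<phi>: "\<phi> \<in> functional_ball K" "realises \<phi>0 y0 r n t \<sigma> \<phi>"
      using \<Psi>(1) \<Psi>(2)[of "\<sigma> \<inter> {..<n}"] realises_cong[of n t t "\<sigma> \<inter> {..<n}" \<sigma>]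
      by (auto simp: \<phi>_def)
    have \<phi>y0: "\<bar>\<phi> (sc b y0) - \<phi>0 (sc b y0)\<bar> \<le> r" if "b \<in> Basis" for b
      using \<phi>(2) that by (simp add: realises_def)
    have \<phi>in: "\<phi> (t i) \<le> lam - \<epsilon> / 2 + r" if "i < n" "i \<in> \<sigma>" for i
      using \<phi>(2) that by (auto simp: realises_def split: if_splits)
    have \<phi>out: "\<bar>\<phi> (sc b (t i)) - \<phi>0 (sc b y0)\<bar> \<le> r" if "i < n" "i \<notin> \<sigma>" "b \<in> Basis" for i b
      using \<phi>(2) that by (auto simp: realises_def split: if_splits)
    show ?thesis
    proof (cases "n \<in> \<sigma>")
      case True
      obtain \<psi> where \<psi>: "\<psi> \<in> functional_ball K'" "\<And>w. w \<in> F \<Longrightarrow> \<bar>\<psi> w - \<phi> w\<bar> \<le> h" "\<psi> x \<le> lam - \<epsilon> / 2"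
        using ext[OF \<phi>(1)] by auto
      have "realises \<phi>0 y0 (r + h) (Suc n) (t(n := x)) \<sigma> \<psi>"
        unfolding realises_def
      proof (intro conjI ballI allI impI)
        fix b :: 'k assume b: "b \<in> Basis"
        then have "sc b y0 \<in> F" by (simp add: F_def)
        from \<psi>(2)[OF this] \<phi>y0[OF b] show "\<bar>\<psi> (sc b y0) - \<phi>0 (sc b y0)\<bar> \<le> r + h" by linarith
      next
        fix i assume i: "i < Suc n"
        show "if i \<in> \<sigma> then \<psi> ((t(n := x)) i) \<le> lam - \<epsilon> / 2 + (r + h)
          else \<forall>b\<in>Basis. \<bar>\<psi> (sc b ((t(n := x)) i)) - \<phi>0 (sc b y0)\<bar> \<le> r + h"
        proof (cases "i = n")
          case True
          then show ?thesis using \<open>n \<in> \<sigma>\<close> \<psi>(3) h by simp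
        next
          case False
          then have i: "i < n" using i by simp
          then have tF: "t i \<in> F" by (simp add: F_def)
          have "\<bar>\<psi> (sc b (t i)) - \<phi>0 (sc b y0)\<bar> \<le> r + h" if "i \<notin> \<sigma>" "b \<in> Basis" for b
          proof -
            have "sc b (t i) \<in> F" unfolding F_def using i that(2) by (intro UnI2) force
            from \<psi>(2)[OF this] \<phi>out[OF i that] show ?thesis by linarith
          qed
          moreover have "\<psi> (t i) \<le> lam - \<epsilon> / 2 + (r + h)" if "i \<in> \<sigma>"
            using \<psi>(2)[OF tF] \<phi>in[OF i that] by linarith
          ultimately show ?thesis using False by simp
        qed
      qed
      then show ?thesis using \<psi>(1) ball_L by blast
    next
      case False
      have near: "\<bar>\<phi> (sc b x) - \<phi> (sc b y0)\<bar> \<le> h" if "b \<in> Basis" for b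
      proof -
        have "(\<lambda>x. \<phi> (sc b x)) \<in> G"
          unfolding G_def \<phi>_def using that by (intro image_eqI[of _ _ "(\<sigma> \<inter> {..<n}, b)"]) auto
        from x(2)[OF this] show ?thesis .
      qed
      have "realises \<phi>0 y0 (r + h) (Suc n) (t(n := x)) \<sigma> \<phi>"
        unfolding realises_def
      proof (intro conjI ballI allI impI)
        fix b :: 'k assume b: "b \<in> Basis"
        from \<phi>y0[OF b] h show "\<bar>\<phi> (sc b y0) - \<phi>0 (sc b y0)\<bar> \<le> r + h" by linarith
      next
        fix i assume i: "i < Suc n"
        show "if i \<in> \<sigma> then \<phi> ((t(n := x)) i) \<le> lam - \<epsilon> / 2 + (r + h)
          else \<forall>b\<in>Basis. \<bar>\<phi> (sc b ((t(n := x)) i)) - \<phi>0 (sc b y0)\<bar> \<le> r + h"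
        proof (cases "i = n")
          case True
          have "\<bar>\<phi> (sc b x) - \<phi>0 (sc b y0)\<bar> \<le> r + h" if "b \<in> Basis" for b
            using near[OF that] \<phi>y0[OF that] by linarith
          with True \<open>n \<notin> \<sigma>\<close> show ?thesis by simp
        next
          case False
          then have i: "i < n" using i by simp
          have "\<bar>\<phi> (sc b (t i)) - \<phi>0 (sc b y0)\<bar> \<le> r + h" if "i \<notin> \<sigma>" "b \<in> Basis" for b
            using \<phi>out[OF i that] h by linarith
          moreover have "\<phi> (t i) \<le> lam - \<epsilon> / 2 + (r + h)" if "i \<in> \<sigma>"
            using \<phi>in[OF i that] h by linarith
          ultimately show ?thesis using False by simp
        qed
      qed
      then show ?thesis using \<phi>(1) ball_L by blast
    qed
  qed
  then show ?thesis
    unfolding independent_upto_def using tn x(1) L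
    by (intro exI[of _ x] conjI exI[of _ L]) (auto simp: less_Suc_eq)
qed

text \<open>The functional may change with \<open>n\<close>; no limit functional is needed, since
  l1-estimates concern finite sums.\<close>

lemma independent_sequence:
  assumes y0: "y0 \<in> C" and \<phi>0: "\<phi>0 \<in> functional_ball 1" and \<theta>: "\<theta> > 0"
  obtains t where "\<And>i. t i \<in> convex hull (slope T)"
    and "\<And>n \<sigma>. \<exists>\<phi>\<in>functional_ball M. realises \<phi>0 y0 \<theta> n t \<sigma> \<phi>"
proof -
  \<comment> \<open>The growing slack absorbs the errors of the first \<open>n\<close> extension steps.\<close>
  define r where "r = (\<lambda>n. \<theta> * (1 - 1 / 2 ^ n))"
  have r: "0 \<le> r n" "r n \<le> \<theta>" for n
    using \<theta> by (simp_all add: r_def mult_le_cancel_left1)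
  have r_Suc: "r (Suc n) = r n + \<theta> / 2 ^ Suc n" for n
    by (simp add: r_def field_simps)
  have "\<exists>f. \<forall>n. independent_upto \<phi>0 y0 (r n) n (f n) \<and> (\<forall>i<n. f (Suc n) i = f n i)"
  proof (rule dependent_nat_choice)
    have "independent_upto \<phi>0 y0 (r 0) 0 (\<lambda>_. 0)"
      unfolding independent_upto_def realises_def using M_bounds(1) \<phi>0
      by (auto simp: r_def intro!: exI[of _ 1] bexI[of _ \<phi>0])
    then show "\<exists>t. independent_upto \<phi>0 y0 (r 0) 0 t" by (rule exI[of _ "\<lambda>_. 0"])
  next
    fix t :: "nat \<Rightarrow> 'a" and n
    assume ind: "independent_upto \<phi>0 y0 (r n) n t"
    have "\<theta> / 2 ^ Suc n > 0" using \<theta> by simp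
    from independent_upto_step[OF ind y0 this r(1)]
    obtain x where "independent_upto \<phi>0 y0 (r (Suc n)) (Suc n) (t(n := x))"
      unfolding r_Suc by blast
    then show "\<exists>t'. independent_upto \<phi>0 y0 (r (Suc n)) (Suc n) t' \<and> (\<forall>i<n. t' i = t i)"
      by (intro exI[of _ "t(n := x)"]) simp
  qed
  then obtain f where f: "\<And>n. independent_upto \<phi>0 y0 (r n) n (f n)" "\<And>n i. i < n \<Longrightarrow> f (Suc n) i = f n i"
    by blast
  define t where "t = (\<lambda>i. f (Suc i) i)"
  have ft: "f (Suc i + k) i = t i" for i k
    by (induction k) (simp_all add: t_def f(2))
  have ft: "f n i = t i" if "i < n" for n i
    using ft[of i "n - Suc i"] that by simp
  show ?thesis
  proof
    fix i
    have "f (Suc i) i \<in> convex hull (slope T)"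
      using f(1)[of "Suc i"] by (simp add: independent_upto_def)
    then show "t i \<in> convex hull (slope T)" by (simp add: t_def)
  next
    fix n \<sigma>
    obtain K \<phi> where K: "1 \<le> K" "K < M" "\<phi> \<in> functional_ball K" "realises \<phi>0 y0 (r n) n (f n) \<sigma> \<phi>"
      using f(1)[of n] unfolding independent_upto_def by blast
    then have "realises \<phi>0 y0 (r n) n t \<sigma> \<phi>"
      using realises_cong[of n "f n" t \<sigma> \<sigma>] ft by blast
    then have "realises \<phi>0 y0 \<theta> n t \<sigma> \<phi>"
      using r(2)[of n] unfolding realises_def by (fastforce split: if_splits)
    moreover have "\<phi> \<in> functional_ball M"
      using K(2,3) functional_ball_mono[of K M] by auto
    ultimately show "\<exists>\<phi>\<in>functional_ball M. realises \<phi>0 y0 \<theta> n t \<sigma> \<phi>" by blast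
  qed
qed

end

section \<open>Scalar directions and the l1-sequence\<close>

lemma finite_net_directions:
  assumes "\<rho> > 0"
  obtains Z :: "'k::{real_normed_field, euclidean_space} set" where "finite Z" and "Z \<subseteq> sphere 0 1"
    and "\<And>c. \<exists>\<zeta>\<in>Z. norm (c - norm c *\<^sub>R \<zeta>) \<le> \<rho> * norm c"
proof -
  have "sphere (0::'k) 1 \<subseteq> (\<Union>z\<in>sphere 0 1. ball z \<rho>)" using assms by auto
  then obtain Z where Z: "Z \<subseteq> sphere (0::'k) 1" "finite Z" "sphere 0 1 \<subseteq> (\<Union>z\<in>Z. ball z \<rho>)"
    by (rule compactE_image[OF compact_sphere open_ball]) blast
  show ?thesis
  proof (rule that[OF Z(2,1)])
    fix c :: 'k
    define u where "u = (if c = 0 then 1 else c /\<^sub>R norm c)"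
    have "u \<in> sphere 0 1" by (simp add: u_def)
    then obtain \<zeta> where \<zeta>: "\<zeta> \<in> Z" "u \<in> ball \<zeta> \<rho>" using Z(3) by blast
    have "c - norm c *\<^sub>R \<zeta> = norm c *\<^sub>R (u - \<zeta>)"
      by (simp add: u_def scaleR_diff_right)
    then have "norm (c - norm c *\<^sub>R \<zeta>) = norm c * norm (u - \<zeta>)" by simp
    also have "\<dots> \<le> norm c * \<rho>"
      using \<zeta>(2) by (intro mult_left_mono) (auto simp: dist_norm norm_minus_commute)
    finally show "\<exists>\<zeta>\<in>Z. norm (c - norm c *\<^sub>R \<zeta>) \<le> \<rho> * norm c"
      using \<zeta>(1) by (intro bexI[of _ \<zeta>]) (simp add: mult.commute)
  qed
qed

lemma linear_bound_Basis:
  fixes h :: "'k::euclidean_space \<Rightarrow> real" and \<theta> :: real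
  assumes lin: "linear h" and h: "\<And>b. b \<in> Basis \<Longrightarrow> \<bar>h b\<bar> \<le> \<theta>"
  shows "\<bar>h c\<bar> \<le> DIM('k) * \<theta> * norm c"
proof -
  have "h c = h (\<Sum>b\<in>Basis. (c \<bullet> b) *\<^sub>R b)" by (simp add: euclidean_representation)
  also have "\<dots> = (\<Sum>b\<in>Basis. (c \<bullet> b) * h b)" by (simp add: linear_sum[OF lin] linear_scale[OF lin])
  also have "\<bar>\<dots>\<bar> \<le> (\<Sum>b\<in>(Basis::'k set). norm c * \<theta>)"
    using h by (intro order_trans[OF sum_abs] sum_mono) (auto simp: abs_mult Basis_le_norm intro!: mult_mono)
  finally show ?thesis by (simp add: algebra_simps)
qed

context gap_scalars
begin

text \<open>By the pigeonhole principle one direction \<open>\<zeta>\<close> of the net carries at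
  least the share \<open>1 / N\<close> of the l1-norm of the coefficients. After rotation these
  coefficients are almost positive. A functional for the pattern \<open>\<sigma>\<close> of their
  indices and one for the empty pattern differ by at least \<open>\<kappa> / 2\<close> times the
  coefficient on \<open>\<sigma>\<close> and almost agree on the other terms, which bounds the norm
  of the sum from below.\<close>

theorem ex_l1_sequence: "\<exists>t. (\<forall>i. t i \<in> C) \<and> l1_sequence sc t"
proof -
  \<comment> \<open>Half of the drop \<open>\<epsilon> / 2\<close>:
    \<open>\<phi>0 y0 > lam - \<kappa>\<close> still exceeds the gap level
    \<open>lam - \<epsilon> / 2\<close> by \<open>\<kappa>\<close>.\<close>
  define \<kappa> where "\<kappa> = \<epsilon> / 4"
  have \<kappa>: "\<kappa> > 0" using \<epsilon>_pos by (simp add: \<kappa>_def)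
  obtain \<phi>0 :: "'a \<Rightarrow> real" and y0 where \<phi>0: "\<phi>0 \<in> functional_ball 1" and y0: "y0 \<in> slope T"
    and "\<phi>0 y0 > lam - \<kappa>"
    by (rule near_slope_functional[OF \<kappa>]) (rule that)
  then have \<phi>0y0: "\<phi>0 y0 \<ge> lam - \<epsilon> / 2 + \<kappa>" by (simp add: \<kappa>_def)
  have y0C: "y0 \<in> C" using y0 slope_subset_C by blast
  \<comment> \<open>Replacing a coefficient by its modulus costs at most
    \<open>3 * lam * \<rho>\<close> times that modulus: one \<open>lam * \<rho>\<close> through
    \<open>p\<close>, two through \<open>\<phi>\<close>, whose bound \<open>M\<close> is at most
    \<open>2\<close>.\<close>
  define \<rho> where "\<rho> = \<kappa> / (12 * (1 + lam))"
  have \<rho>: "\<rho> > 0" "3 * lam * \<rho> \<le> \<kappa> / 4"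
    using \<kappa> lam_nonneg by (simp_all add: \<rho>_def field_simps)
  obtain Z :: "'k set" where Z: "finite Z" "Z \<subseteq> sphere 0 1"
    and net: "\<And>c. \<exists>\<zeta>\<in>Z. norm (c - norm c *\<^sub>R \<zeta>) \<le> \<rho> * norm c"
    by (rule finite_net_directions[OF \<rho>(1)]) (rule that)
  define N where "N = real (card Z)"
  have "Z \<noteq> {}" using net by blast
  then have N: "N \<ge> 1" using Z(1) by (simp add: N_def Suc_le_eq card_gt_0_iff)
  define d where "d = real DIM('k)"
  have d: "d \<ge> 1" by (simp add: d_def Suc_le_eq)
  \<comment> \<open>The terms outside \<open>\<sigma>\<close> lose at most
    \<open>2 * (d * \<theta>)\<close> times the whole l1-norm. This must stay well below the gain,
    which is only guaranteed on the share \<open>1 / N\<close>.\<close>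
  define \<theta> where "\<theta> = \<kappa> / (16 * N * d)"
  have \<theta>: "\<theta> > 0" using \<kappa> N d by (simp add: \<theta>_def)
  have \<theta>d: "d * \<theta> = \<kappa> / (16 * N)" using d by (simp add: \<theta>_def)
  have \<theta>\<kappa>: "\<theta> + d * \<theta> \<le> \<kappa> / 8"
  proof -
    have "\<theta> \<le> d * \<theta>" using \<theta> d by simp
    moreover have "d * \<theta> \<le> \<kappa> / 16" unfolding \<theta>d using \<kappa> N by (simp add: field_simps)
    ultimately show ?thesis by simp
  qed
  obtain t where t: "\<And>i. t i \<in> convex hull (slope T)"
    and tree: "\<And>n \<sigma>. \<exists>\<phi>\<in>functional_ball M. realises \<phi>0 y0 \<theta> n t \<sigma> \<phi>"
    by (rule independent_sequence[OF y0C \<phi>0 \<theta>]) (rule that)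
  have tC: "t i \<in> C" for i using t hull_subset_C by blast
  have t_le: "norm (t i) \<le> lam" for i using norm_C_le[OF tC] .
  define p where "p = (\<lambda>c. \<phi>0 (sc c y0))"
  have \<phi>0_bl: "bounded_linear \<phi>0" and \<phi>0_le: "\<And>x. \<bar>\<phi>0 x\<bar> \<le> norm x"
    using \<phi>0 by (auto simp: functional_ball_def)
  have p_lin: "linear p"
    unfolding p_def
    by (rule bounded_linear.linear[OF bounded_linear_compose[OF \<phi>0_bl bounded_linear_sc_left]])
  have p_le: "\<bar>p c\<bar> \<le> lam * norm c" for c
  proof -
    have "\<bar>p c\<bar> \<le> norm c * norm y0" using \<phi>0_le[of "sc c y0"] by (simp add: p_def norm_sc)
    also have "\<dots> \<le> norm c * lam" using norm_C_le[OF y0C] by (intro mult_left_mono) auto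
    finally show ?thesis by (simp add: mult.commute)
  qed
  have lower: "\<kappa> / (16 * N) * (\<Sum>i<n. norm (c i)) \<le> norm (\<Sum>i<n. sc (c i) (t i))" for n c
  proof -
    have "\<forall>i. \<exists>\<zeta>. \<zeta> \<in> Z \<and> norm (c i - norm (c i) *\<^sub>R \<zeta>) \<le> \<rho> * norm (c i)"
      using net by blast
    from choice[OF this] obtain k
      where k: "\<And>i. k i \<in> Z" "\<And>i. norm (c i - norm (c i) *\<^sub>R k i) \<le> \<rho> * norm (c i)"
      by blast
    have group: "(\<Sum>\<zeta>\<in>Z. \<Sum>i\<in>{i \<in> {..<n}. k i = \<zeta>}. norm (c i)) = (\<Sum>i<n. norm (c i))"
      using k(1) Z(1) by (intro sum.group) auto
    have "\<exists>\<zeta>\<in>Z. (\<Sum>i<n. norm (c i)) / N \<le> (\<Sum>i\<in>{i \<in> {..<n}. k i = \<zeta>}. norm (c i))"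
    proof (rule ccontr)
      assume "\<not> ?thesis"
      then have "(\<Sum>\<zeta>\<in>Z. \<Sum>i\<in>{i \<in> {..<n}. k i = \<zeta>}. norm (c i)) < (\<Sum>\<zeta>\<in>Z. (\<Sum>i<n. norm (c i)) / N)"
        using Z(1) \<open>Z \<noteq> {}\<close> by (intro sum_strict_mono) (auto simp: not_le)
      then show False using group N by (simp add: N_def)
    qed
    then obtain \<zeta> where \<zeta>: "\<zeta> \<in> Z"
      and big: "(\<Sum>i<n. norm (c i)) / N \<le> (\<Sum>i\<in>{i \<in> {..<n}. k i = \<zeta>}. norm (c i))" by blast
    have n\<zeta>: "norm \<zeta> = 1" using \<zeta> Z(2) by auto
    then have \<zeta>0: "\<zeta> \<noteq> 0" by auto
    define \<sigma> where "\<sigma> = {i. k i = \<zeta>}"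
    \<comment> \<open>Dividing by \<open>\<zeta>\<close> turns the coefficients with indices in
      \<open>\<sigma>\<close> into almost nonnegative reals and preserves all norms.\<close>
    define c' where "c' = (\<lambda>i. inverse \<zeta> * c i)"
    have nc': "norm (c' i) = norm (c i)" for i using n\<zeta> by (simp add: c'_def norm_mult norm_inverse)
    have c'\<sigma>: "norm (c' i - of_real (norm (c i))) \<le> \<rho> * norm (c i)" if "i \<in> \<sigma>" for i
    proof -
      have "c' i - of_real (norm (c i)) = inverse \<zeta> * (c i - norm (c i) *\<^sub>R \<zeta>)"
        using \<zeta>0 by (simp add: c'_def right_diff_distrib scaleR_conv_of_real)
      then have "norm (c' i - of_real (norm (c i))) = norm (c i - norm (c i) *\<^sub>R \<zeta>)"
        using n\<zeta> by (simp add: norm_mult norm_inverse)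
      then show ?thesis using k(2)[of i] that by (simp add: \<sigma>_def)
    qed
    define X where "X = (\<Sum>i<n. sc (c' i) (t i))"
    have "X = sc (inverse \<zeta>) (\<Sum>i<n. sc (c i) (t i))"
      by (simp add: X_def c'_def linear_sum[OF bounded_linear.linear[OF bounded_linear_sc_right]] sc_sc)
    then have normX: "norm X = norm (\<Sum>i<n. sc (c i) (t i))"
      using n\<zeta> by (simp add: norm_sc norm_inverse)
    obtain \<phi> where \<phi>: "\<phi> \<in> functional_ball M" "realises \<phi>0 y0 \<theta> n t \<sigma> \<phi>" using tree by blast
    obtain \<psi> where \<psi>: "\<psi> \<in> functional_ball M" "realises \<phi>0 y0 \<theta> n t {} \<psi>" using tree by blast
    \<comment> \<open>The difference is real-linear in the scalar \<open>c\<close>, so the control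
      at the basis scalars in \<open>realises\<close> extends to every scalar at the cost of the
      factor \<open>d\<close>.\<close>
    have near: "\<bar>\<xi> (sc c (t i)) - p c\<bar> \<le> d * \<theta> * norm c"
      if "\<xi> \<in> functional_ball M" "realises \<phi>0 y0 \<theta> n t \<tau> \<xi>" "i < n" "i \<notin> \<tau>" for \<xi> \<tau> c i
    proof -
      have "bounded_linear \<xi>" using that(1) by (simp add: functional_ball_def)
      then have "linear (\<lambda>c. \<xi> (sc c (t i)))"
        by (rule bounded_linear.linear[OF bounded_linear_compose[OF _ bounded_linear_sc_left]])
      then have L: "linear (\<lambda>c. \<xi> (sc c (t i)) - p c)" using p_lin by (rule linear_compose_sub)
      have B: "\<bar>\<xi> (sc b (t i)) - p b\<bar> \<le> \<theta>" if "b \<in> Basis" for b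
        using conjunct2[OF \<open>realises \<phi>0 y0 \<theta> n t \<tau> \<xi>\<close>[unfolded realises_def], rule_format, OF \<open>i < n\<close>]
          \<open>i \<notin> \<tau>\<close> that by (simp add: p_def)
      show ?thesis unfolding d_def by (rule linear_bound_Basis[OF L B])
    qed
    have term_out: "- (2 * (d * \<theta>)) * norm (c i) \<le> \<psi> (sc (c' i) (t i)) - \<phi> (sc (c' i) (t i))"
      if "i < n" "i \<notin> \<sigma>" for i
    proof -
      have "\<bar>\<psi> (sc (c' i) (t i)) - p (c' i)\<bar> \<le> d * \<theta> * norm (c i)"
        using near[OF \<psi> that(1), of "c' i"] by (simp add: nc')
      moreover have "\<bar>\<phi> (sc (c' i) (t i)) - p (c' i)\<bar> \<le> d * \<theta> * norm (c i)"
        using near[OF \<phi> that, of "c' i"] by (simp add: nc')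
      moreover have "- (2 * (d * \<theta>)) * norm (c i) = - (2 * (d * \<theta> * norm (c i)))" by simp
      ultimately show ?thesis by linarith
    qed
    have \<phi>in: "\<phi> (t i) \<le> lam - \<epsilon> / 2 + \<theta>" if "i < n" "i \<in> \<sigma>" for i
      using conjunct2[OF \<phi>(2)[unfolded realises_def], rule_format, OF that(1)] that(2) by simp
    have term_in: "\<kappa> / 2 * norm (c i) \<le> \<psi> (sc (c' i) (t i)) - \<phi> (sc (c' i) (t i))"
      if i: "i < n" "i \<in> \<sigma>" for i
    proof -
      define u where "u = norm (c i)"
      define e where "e = c' i - of_real u"
      have ne: "norm e \<le> \<rho> * u" using c'\<sigma>[OF i(2)] by (simp add: e_def u_def)
      have c'e: "c' i = of_real u + e" by (simp add: e_def)
      have "\<phi> (sc (c' i) (t i)) = u * \<phi> (t i) + \<phi> (sc e (t i))"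
      proof -
        have lin: "linear \<phi>" using \<phi>(1) by (simp add: functional_ball_def bounded_linear.linear)
        show ?thesis unfolding c'e by (simp add: sc_add_left sc_of_real linear_add[OF lin] linear_scale[OF lin])
      qed
      moreover have "u * \<phi> (t i) \<le> u * (lam - \<epsilon> / 2 + \<theta>)"
        using \<phi>(2) i by (intro mult_left_mono) (simp_all add: \<phi>in u_def)
      moreover have "\<phi> (sc e (t i)) \<le> 2 * (\<rho> * u * lam)"
      proof -
        have "\<bar>\<phi> (sc e (t i))\<bar> \<le> M * (norm e * norm (t i))"
          using \<phi>(1) by (simp add: functional_ball_def flip: norm_sc)
        also have "\<dots> \<le> 2 * (\<rho> * u * lam)"
          using M_bounds ne t_le[of i] order_trans[OF norm_ge_zero ne] by (intro mult_mono) auto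
        finally show ?thesis by simp
      qed
      moreover have "p (c' i) = u * \<phi>0 y0 + p e"
        unfolding c'e linear_add[OF p_lin] by (simp add: p_def sc_of_real linear_scale[OF bounded_linear.linear[OF \<phi>0_bl]])
      moreover have "u * \<phi>0 y0 \<ge> u * (lam - \<epsilon> / 2 + \<kappa>)"
        using \<phi>0y0 by (intro mult_left_mono) (auto simp: u_def)
      moreover have "\<bar>p e\<bar> \<le> \<rho> * u * lam"
        using p_le[of e] mult_left_mono[OF ne lam_nonneg] by (simp add: mult.commute)
      moreover have "\<psi> (sc (c' i) (t i)) \<ge> p (c' i) - d * \<theta> * u"
        using near[OF \<psi> i(1), of "c' i"] nc'[of i] by (simp add: u_def)
      ultimately have "\<psi> (sc (c' i) (t i)) - \<phi> (sc (c' i) (t i)) \<ge>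
          u * (lam - \<epsilon> / 2 + \<kappa>) - \<rho> * u * lam - d * \<theta> * u - u * (lam - \<epsilon> / 2 + \<theta>) - 2 * (\<rho> * u * lam)"
        by linarith
      also have "u * (lam - \<epsilon> / 2 + \<kappa>) - \<rho> * u * lam - d * \<theta> * u - u * (lam - \<epsilon> / 2 + \<theta>) - 2 * (\<rho> * u * lam)
          = u * (\<kappa> - (\<theta> + d * \<theta>) - 3 * lam * \<rho>)"
        by (simp add: algebra_simps)
      also have "u * (\<kappa> - (\<theta> + d * \<theta>) - 3 * lam * \<rho>) \<ge> u * (\<kappa> / 2)"
        using \<theta>\<kappa> \<rho>(2) \<kappa> by (intro mult_left_mono) (auto simp: u_def)
      finally show ?thesis by (simp add: u_def mult.commute)
    qed
    have split: "(\<Sum>i<n. f i) = (\<Sum>i\<in>{i \<in> {..<n}. i \<in> \<sigma>}. f i) + (\<Sum>i\<in>{i \<in> {..<n}. i \<notin> \<sigma>}. f i)"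
      for f :: "nat \<Rightarrow> real"
      by (subst sum.union_disjoint[symmetric]) (auto intro!: sum.cong)
    define S where "S = (\<Sum>i<n. norm (c i))"
    have S0: "S \<ge> 0" by (simp add: S_def sum_nonneg)
    have inn: "(\<Sum>i\<in>{i \<in> {..<n}. i \<in> \<sigma>}. norm (c i)) \<ge> S / N"
      using big by (simp add: S_def \<sigma>_def)
    have out: "(\<Sum>i\<in>{i \<in> {..<n}. i \<notin> \<sigma>}. norm (c i)) \<le> S"
      unfolding S_def by (intro sum_mono2) auto
    have "\<psi> X - \<phi> X = (\<Sum>i<n. \<psi> (sc (c' i) (t i)) - \<phi> (sc (c' i) (t i)))"
    proof -
      have "linear \<psi>" "linear \<phi>" using \<phi>(1) \<psi>(1) by (simp_all add: functional_ball_def bounded_linear.linear)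
      then show ?thesis by (simp add: X_def linear_sum sum_subtractf)
    qed
    also have "\<dots> \<ge> (\<Sum>i\<in>{i \<in> {..<n}. i \<in> \<sigma>}. \<kappa> / 2 * norm (c i)) +
        (\<Sum>i\<in>{i \<in> {..<n}. i \<notin> \<sigma>}. - (2 * (d * \<theta>)) * norm (c i))"
      unfolding split using term_in term_out by (intro add_mono sum_mono) auto
    also have "(\<Sum>i\<in>{i \<in> {..<n}. i \<in> \<sigma>}. \<kappa> / 2 * norm (c i)) = \<kappa> / 2 * (\<Sum>i\<in>{i \<in> {..<n}. i \<in> \<sigma>}. norm (c i))"
      by (simp only: sum_distrib_left)
    also have "(\<Sum>i\<in>{i \<in> {..<n}. i \<notin> \<sigma>}. - (2 * (d * \<theta>)) * norm (c i)) =
        - (2 * (d * \<theta>)) * (\<Sum>i\<in>{i \<in> {..<n}. i \<notin> \<sigma>}. norm (c i))"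
      by (simp only: sum_distrib_left)
    finally have diff: "\<psi> X - \<phi> X \<ge> \<kappa> / 2 * (\<Sum>i\<in>{i \<in> {..<n}. i \<in> \<sigma>}. norm (c i)) +
        - (2 * (d * \<theta>)) * (\<Sum>i\<in>{i \<in> {..<n}. i \<notin> \<sigma>}. norm (c i))" .
    have "\<kappa> / 2 * (\<Sum>i\<in>{i \<in> {..<n}. i \<in> \<sigma>}. norm (c i)) \<ge> \<kappa> / 2 * (S / N)"
      using inn \<kappa> by (intro mult_left_mono) auto
    moreover have "2 * (d * \<theta>) * (\<Sum>i\<in>{i \<in> {..<n}. i \<notin> \<sigma>}. norm (c i)) \<le> 2 * (d * \<theta>) * S"
      using out \<theta> d by (intro mult_left_mono) auto
    ultimately have "\<psi> X - \<phi> X \<ge> \<kappa> / 2 * (S / N) - 2 * (\<kappa> / (16 * N)) * S"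
      using diff unfolding \<theta>d by linarith
    also have "\<kappa> / 2 * (S / N) - 2 * (\<kappa> / (16 * N)) * S = 6 * (\<kappa> / (16 * N) * S)"
      using N by (simp add: field_simps)
    finally have "6 * (\<kappa> / (16 * N) * S) \<le> \<psi> X - \<phi> X" .
    moreover have "\<psi> X - \<phi> X \<le> 4 * norm X"
    proof -
      have "\<bar>\<psi> X\<bar> \<le> M * norm X" "\<bar>\<phi> X\<bar> \<le> M * norm X"
        using \<phi>(1) \<psi>(1) by (auto simp: functional_ball_def)
      moreover have "M * norm X \<le> 2 * norm X" using M_bounds by (intro mult_right_mono) auto
      ultimately show ?thesis by linarith
    qed
    moreover have "0 \<le> \<kappa> / (16 * N) * S" using \<kappa> N S0 by simp
    ultimately show ?thesis unfolding normX S_def[symmetric] by linarith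
  qed
  have upper: "norm (\<Sum>i<n. sc (c i) (t i)) \<le> lam * (\<Sum>i<n. norm (c i))" for n c
    unfolding sum_distrib_left using t_le
    by (intro sum_norm_le) (simp add: norm_sc mult.commute mult_right_mono)
  have "\<kappa> / (16 * N) > 0" using \<kappa> N by simp
  then have "l1_sequence sc t"
    unfolding l1_sequence_def using lower upper by blast
  then show ?thesis using tC by blast
qed

corollary not_no_l1_sequences: "\<not> no_l1_sequences sc C"
  using ex_l1_sequence by (auto simp: no_l1_sequences_def)

end

section \<open>Asplund property and CPCP\<close>

context scalar_structure
begin

text \<open>On the span of the sequence, summing the real parts of the coefficients with index in
  \<open>\<sigma>\<close> is bounded by \<open>1 / m\<close> through the lower l1-estimate. The cone
  \<open>\<Lambda>\<close> collects these values and is a real subspace, so the one-sided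
  Hahn--Banach bound becomes an equality.\<close>

lemma l1_sequence_real_interpolation:
  assumes e: "l1_sequence sc e"
  obtains f where "bounded_linear (f :: 'a \<Rightarrow> real)" and "\<And>n. f (e n) = of_bool (n \<in> \<sigma>)"
proof -
  obtain m where m: "m > 0" and low: "\<And>n a. m * (\<Sum>i<n. norm (a i)) \<le> norm (\<Sum>i<n. sc (a i) (e i))"
    using e unfolding l1_sequence_def by blast
  define w where "w = (\<lambda>n a. \<Sum>i<n. re (a i) * of_bool (i \<in> \<sigma>))"
  define comb where "comb = (\<lambda>n a. \<Sum>i<n. sc (a i) (e i))"
  define \<Lambda> where "\<Lambda> = {(comb n a, w n a) | n a. True}"
  have \<Lambda>I: "(comb n a, w n a) \<in> \<Lambda>" for n a unfolding \<Lambda>_def by blast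
  have extend: "comb N (\<lambda>i. if i < n then a i else 0) = comb n a"
      "w N (\<lambda>i. if i < n then a i else 0) = w n a" if "n \<le> N" for n N a
  proof -
    have sum: "(\<Sum>i<N. if i < n then g i else 0) = (\<Sum>i<n. g i)" for g :: "nat \<Rightarrow> 'b::comm_monoid_add"
      using that by (intro sum.mono_neutral_cong_right) auto
    show "comb N (\<lambda>i. if i < n then a i else 0) = comb n a"
      unfolding comb_def sum[symmetric] by (intro sum.cong) (auto simp: sc_zero)
    show "w N (\<lambda>i. if i < n then a i else 0) = w n a"
      unfolding w_def sum[symmetric] by (intro sum.cong) (auto simp: linear_0[OF linear_re])
  qed
  have add: "(x + y, r + s) \<in> \<Lambda>" if xr_ys: "(x, r) \<in> \<Lambda>" "(y, s) \<in> \<Lambda>" for x r y s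
  proof -
    obtain n a k b where xy: "x = comb n a" "r = w n a" "y = comb k b" "s = w k b"
      using xr_ys unfolding \<Lambda>_def by blast
    define a' b' where "a' = (\<lambda>i. if i < n then a i else 0)" and "b' = (\<lambda>i. if i < k then b i else 0)"
    have a': "comb (max n k) a' = x" "w (max n k) a' = r" and b': "comb (max n k) b' = y" "w (max n k) b' = s"
      unfolding a'_def b'_def xy by (simp_all add: extend)
    have "comb (max n k) (\<lambda>i. a' i + b' i) = x + y"
      unfolding a'(1)[symmetric] b'(1)[symmetric] by (simp add: comb_def sc_add_left sum.distrib)
    moreover have "w (max n k) (\<lambda>i. a' i + b' i) = r + s"
      unfolding a'(2)[symmetric] b'(2)[symmetric] w_def sum.distrib[symmetric]
      by (simp only: linear_add[OF linear_re] distrib_right)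
    ultimately show ?thesis using \<Lambda>I[of "max n k" "\<lambda>i. a' i + b' i"] by simp
  qed
  have scale: "(u *\<^sub>R x, u * r) \<in> \<Lambda>" if mem: "(x, r) \<in> \<Lambda>" for u x r
  proof -
    obtain n a where xr: "x = comb n a" "r = w n a"
      using mem unfolding \<Lambda>_def by blast
    have "comb n (\<lambda>i. u *\<^sub>R a i) = u *\<^sub>R x"
      by (simp add: comb_def xr sc_scaleR_left scaleR_sum_right)
    moreover have "w n (\<lambda>i. u *\<^sub>R a i) = u * r"
      by (simp add: w_def xr linear_scale[OF linear_re] sum_distrib_left mult.assoc)
    ultimately show ?thesis using \<Lambda>I[of n "\<lambda>i. u *\<^sub>R a i"] by simp
  qed
  have bound: "r \<le> 1 / m * norm x" if mem: "(x, r) \<in> \<Lambda>" for x r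
  proof -
    obtain n a where xr: "x = comb n a" "r = w n a"
      using mem unfolding \<Lambda>_def by blast
    have "re (a i) * of_bool (i \<in> \<sigma>) \<le> norm (a i)" for i
      using abs_re_le[of "a i"] by (cases "i \<in> \<sigma>") auto
    then have "r \<le> (\<Sum>i<n. norm (a i))" unfolding xr w_def by (rule sum_mono)
    also have "\<dots> \<le> 1 / m * norm x"
      using low[where n = n and a = a] m by (simp add: xr comb_def field_simps)
    finally show ?thesis .
  qed
  obtain f where f: "bounded_linear f" "\<And>x r. (x, r) \<in> \<Lambda> \<Longrightarrow> r \<le> f x"
  proof (rule hahn_banach_cone[of \<Lambda> "1 / m"])
    show "(0, 0) \<in> \<Lambda>" using \<Lambda>I[of 0] by (simp add: comb_def w_def)
  qed (use add scale bound m in auto)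
  have "f (e n) = of_bool (n \<in> \<sigma>)" for n
  proof -
    define a :: "nat \<Rightarrow> 'k" where "a = (\<lambda>i. if i = n then 1 else 0)"
    have "comb (Suc n) a = e n" by (simp add: comb_def a_def sc_one sc_zero)
    moreover have "w (Suc n) a = of_bool (n \<in> \<sigma>)"
    proof -
      have "w (Suc n) a = (\<Sum>i<Suc n. if i = n then of_bool (n \<in> \<sigma>) else 0)"
        unfolding w_def a_def using re_one linear_0[OF linear_re] by (intro sum.cong) auto
      then show ?thesis by simp
    qed
    ultimately have en: "(e n, of_bool (n \<in> \<sigma>)) \<in> \<Lambda>"
      using \<Lambda>I[of "Suc n" a] by simp
    have "of_bool (n \<in> \<sigma>) \<le> f (e n)" by (rule f(2)[OF en])
    moreover have "- of_bool (n \<in> \<sigma>) \<le> f (- e n)" using f(2)[OF scale[OF en, of "-1"]] by simp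
    ultimately show ?thesis using linear_neg[OF bounded_linear.linear[OF f(1)], of "e n"] by simp
  qed
  with f(1) show ?thesis by (rule that)
qed

text \<open>Functionals for different \<open>0/1\<close> patterns differ by at least
  \<open>1\<close> on some term of the sequence, so approximations within \<open>1 / 2\<close> from
  \<open>Q\<close> are distinct. A countable \<open>Q\<close> would make the power set of the
  naturals countable.\<close>

lemma asplund_imp_no_l1_sequences:
  assumes "asplund_property sc C"
  shows "no_l1_sequences sc C"
  unfolding no_l1_sequences_def
proof
  assume "\<exists>e. (\<forall>n. e n \<in> C) \<and> l1_sequence sc e"
  then obtain e where eC: "\<And>n. e n \<in> C" and e: "l1_sequence sc e" by blast
  obtain L where L: "\<And>n a. norm (\<Sum>i<n. sc (a i) (e i)) \<le> L * (\<Sum>i<n. norm (a i))"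
    using e unfolding l1_sequence_def by blast
  have e_le: "norm (e n) \<le> L" for n
    using L[where n = "Suc n" and a = "\<lambda>i. if i = n then 1 else 0"] by (simp add: sc_one sc_zero)
  define B where "B = range e"
  have "countable B" "B \<subseteq> C" using eC by (auto simp: B_def)
  then have "\<exists>Q. countable Q \<and> Q \<subseteq> dual_space sc \<and>
      (\<forall>f\<in>dual_space sc. \<forall>\<delta>>0. \<exists>q\<in>Q. rho B (\<lambda>x. f x - q x) < \<delta>)"
    using assms[unfolded asplund_property_def, rule_format, of B] by simp
  then obtain Q where Q: "countable Q" "Q \<subseteq> dual_space sc"
    and dense: "\<forall>f\<in>dual_space sc. \<forall>\<delta>>0. \<exists>q\<in>Q. rho B (\<lambda>x. f x - q x) < \<delta>"
    by (elim exE conjE)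
  have "\<exists>F\<in>dual_space sc. \<forall>n. re (F (e n)) = of_bool (n \<in> \<sigma>)" for \<sigma>
  proof -
    obtain f :: "'a \<Rightarrow> real" where f: "bounded_linear f" "\<And>n. f (e n) = of_bool (n \<in> \<sigma>)"
      by (rule l1_sequence_real_interpolation[OF e, of \<sigma>]) (rule that)
    obtain F where "F \<in> dual_space sc" "\<And>x. re (F x) = f x"
      using ex_dual_re[OF f(1)] by blast
    with f(2) show ?thesis by (intro bexI[of _ F]) simp_all
  qed
  then have "\<forall>\<sigma>. \<exists>F. F \<in> dual_space sc \<and> (\<forall>n. re (F (e n)) = of_bool (n \<in> \<sigma>))" by blast
  from choice[OF this] obtain F where F: "\<And>\<sigma>. F \<sigma> \<in> dual_space sc"
    "\<And>\<sigma> n. re (F \<sigma> (e n)) = of_bool (n \<in> \<sigma>)" by blast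
  have "\<forall>\<sigma>. \<exists>q. q \<in> Q \<and> rho B (\<lambda>x. F \<sigma> x - q x) < 1 / 2"
  proof
    fix \<sigma>
    have "\<exists>q\<in>Q. rho B (\<lambda>x. F \<sigma> x - q x) < 1 / 2"
      by (rule dense[rule_format, OF F(1)]) simp
    then show "\<exists>q. q \<in> Q \<and> rho B (\<lambda>x. F \<sigma> x - q x) < 1 / 2" by blast
  qed
  from choice[OF this] obtain q where q: "\<And>\<sigma>. q \<sigma> \<in> Q" "\<And>\<sigma>. rho B (\<lambda>x. F \<sigma> x - q \<sigma> x) < 1 / 2"
    by blast
  have close: "norm (F \<sigma> (e n) - q \<sigma> (e n)) < 1 / 2" for \<sigma> n
  proof -
    have "bounded_linear (\<lambda>x. F \<sigma> x - q \<sigma> x)"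
      using F(1)[of \<sigma>] q(1)[of \<sigma>] Q(2) by (intro bounded_linear_sub) (auto simp: dual_space_def)
    then obtain K where K: "K > 0" "\<And>x. norm (F \<sigma> x - q \<sigma> x) \<le> norm x * K"
      using bounded_linear.pos_bounded by blast
    have "norm (F \<sigma> (e k) - q \<sigma> (e k)) \<le> L * K" for k
      using K(2)[of "e k"] mult_right_mono[OF e_le[of k], of K] K(1) by linarith
    \<comment> \<open>The real supremum in \<open>rho\<close> controls single values only for sets
      bounded above; boundedness of the sequence comes from the upper l1-estimate.\<close>
    then have "bdd_above ((\<lambda>b. norm (F \<sigma> b - q \<sigma> b)) ` B)"
      unfolding B_def by (intro bdd_aboveI[of _ "L * K"]) auto
    then have "norm (F \<sigma> (e n) - q \<sigma> (e n)) \<le> (SUP b\<in>B. norm (F \<sigma> b - q \<sigma> b))"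
      by (rule cSUP_upper[rotated]) (simp add: B_def)
    also have "\<dots> < 1 / 2" using q(2)[of \<sigma>] by (simp add: rho_def B_def)
    finally show ?thesis .
  qed
  have "inj q"
  proof (rule injI)
    fix \<sigma> \<tau> assume eq: "q \<sigma> = q \<tau>"
    have "n \<in> \<sigma> \<longleftrightarrow> n \<in> \<tau>" for n
    proof -
      have "\<bar>re (F \<sigma> (e n) - F \<tau> (e n))\<bar> \<le> norm ((F \<sigma> (e n) - q \<sigma> (e n)) - (F \<tau> (e n) - q \<tau> (e n)))"
        using abs_re_le[of "F \<sigma> (e n) - F \<tau> (e n)"] eq by simp
      also have "\<dots> \<le> norm (F \<sigma> (e n) - q \<sigma> (e n)) + norm (F \<tau> (e n) - q \<tau> (e n))"
        by (rule norm_triangle_ineq4)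
      finally have "\<bar>of_bool (n \<in> \<sigma>) - of_bool (n \<in> \<tau>) :: real\<bar> < 1"
        using close[of \<sigma> n] close[of \<tau> n] by (simp add: linear_diff[OF linear_re] F(2))
      then show ?thesis by (cases "n \<in> \<sigma>"; cases "n \<in> \<tau>") auto
    qed
    then show "\<sigma> = \<tau>" by blast
  qed
  moreover have "countable (range q)"
    by (rule countable_subset[OF _ Q(1)]) (use q(1) in blast)
  ultimately have "countable (UNIV :: nat set set)"
    using countable_image_inj_on by blast
  then obtain h :: "nat set \<Rightarrow> nat" where "inj h" by (rule countableE)
  then have "surj (inv h)" by (rule inj_imp_surj_inv)
  then have "inv h ` UNIV = Pow UNIV" by simp
  then show False using Cantors_theorem[of "UNIV :: nat set"] by blast
qed

section \<open>Basic weak neighbourhoods and CPCP\<close>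

lemma weak_nbhd:
  assumes "generate_topology_on {f -` U | f U. f \<in> dual_space sc \<and> open U} W" and "x \<in> W"
  shows "\<exists>G \<delta>. finite G \<and> G \<subseteq> dual_space sc \<and> \<delta> > 0 \<and> {t. \<forall>f\<in>G. norm (f t - f x) < \<delta>} \<subseteq> W"
  using assms
proof (induction rule: generate_topology_on.induct)
  case (Int V W)
  then have "x \<in> V" "x \<in> W" by simp_all
  from Int.IH(1)[OF this(1)] obtain G \<delta> where G: "finite G" "G \<subseteq> dual_space sc" "\<delta> > 0"
    "{t. \<forall>f\<in>G. norm (f t - f x) < \<delta>} \<subseteq> V" by (elim exE conjE)
  from Int.IH(2)[OF \<open>x \<in> W\<close>] obtain H \<gamma> where H: "finite H" "H \<subseteq> dual_space sc" "\<gamma> > 0"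
    "{t. \<forall>f\<in>H. norm (f t - f x) < \<gamma>} \<subseteq> W" by (elim exE conjE)
  have "{t. \<forall>f\<in>G \<union> H. norm (f t - f x) < min \<delta> \<gamma>} \<subseteq> V \<inter> W"
    using G(4) H(4) by auto
  with G(1-3) H(1-3) show ?case
    by (intro exI[of _ "G \<union> H"] exI[of _ "min \<delta> \<gamma>"]) simp
next
  case (UN \<W>)
  then obtain W where W: "W \<in> \<W>" "x \<in> W" by blast
  from UN.IH[OF this] obtain G \<delta> where G: "finite G" "G \<subseteq> dual_space sc" "\<delta> > 0"
    "{t. \<forall>f\<in>G. norm (f t - f x) < \<delta>} \<subseteq> W" by (elim exE conjE)
  from G(4) W(1) have "{t. \<forall>f\<in>G. norm (f t - f x) < \<delta>} \<subseteq> \<Union>\<W>" by blast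
  with G(1-3) show ?case by (intro exI[of _ G] exI[of _ \<delta>]) simp
next
  case (Basis W)
  then obtain f U where f: "f \<in> dual_space sc" "open U" "W = f -` U" by blast
  have "f x \<in> U" using Basis.prems f(3) by simp
  then obtain \<delta> where \<delta>: "\<delta> > 0" "ball (f x) \<delta> \<subseteq> U"
    using f(2) open_contains_ball by blast
  have "{t. \<forall>g\<in>{f}. norm (g t - g x) < \<delta>} \<subseteq> W"
  proof
    fix t assume "t \<in> {t. \<forall>g\<in>{f}. norm (g t - g x) < \<delta>}"
    then have "f t \<in> ball (f x) \<delta>" by (simp add: dist_norm norm_minus_commute)
    with \<delta>(2) f(3) show "t \<in> W" by blast
  qed
  then show ?case using f(1) \<delta>(1) by (intro exI[of _ "{f}"] exI[of _ \<delta>]) simp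
qed simp

lemma cpcp_point:
  assumes "cpcp sc C" and D: "D \<subseteq> C" "D \<noteq> {}" "closed D" "convex D" and r: "r > 0"
  obtains x G \<eta> where "x \<in> D" and "finite G" and "\<And>f. f \<in> G \<Longrightarrow> bounded_linear (f :: 'a \<Rightarrow> real)"
    and "\<eta> > 0" and "\<And>t. t \<in> D \<Longrightarrow> \<forall>f\<in>G. \<bar>f t - f x\<bar> < \<eta> \<Longrightarrow> norm (t - x) \<le> r"
proof -
  have "\<exists>x\<in>D. topcontinuous_at (subtopology (weak_topology sc) D) (top_of_set D) (\<lambda>y. y) x"
    using assms(1)[unfolded cpcp_def, rule_format, of D] D by simp
  then obtain x where x: "x \<in> D" and
    cont: "topcontinuous_at (subtopology (weak_topology sc) D) (top_of_set D) (\<lambda>y. y) x"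
    by (elim bexE)
  have "openin (top_of_set D) (D \<inter> ball x r) \<and> x \<in> D \<inter> ball x r"
    using x r by (simp add: openin_open_Int)
  moreover have "\<forall>U. openin (top_of_set D) U \<and> x \<in> U \<longrightarrow>
      (\<exists>V. openin (subtopology (weak_topology sc) D) V \<and> x \<in> V \<and> (\<forall>y\<in>V. y \<in> U))"
    using cont unfolding topcontinuous_at_def by simp
  ultimately have "\<exists>V. openin (subtopology (weak_topology sc) D) V \<and> x \<in> V \<and> (\<forall>y\<in>V. y \<in> D \<inter> ball x r)"
    by (elim allE) (erule (1) mp)
  then obtain V where V: "openin (subtopology (weak_topology sc) D) V" "x \<in> V"
      "\<And>y. y \<in> V \<Longrightarrow> y \<in> D \<inter> ball x r"
    by (elim exE conjE) blast
  then obtain W where W: "openin (weak_topology sc) W" "V = W \<inter> D"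
    unfolding openin_subtopology by blast
  have gen: "generate_topology_on {f -` U | f U. f \<in> dual_space sc \<and> open U} W"
    using W(1) unfolding weak_topology_def by (rule openin_topology_generated_by)
  have "x \<in> W" using V(2) W(2) by blast
  from weak_nbhd[OF gen this] obtain G \<delta> where G: "finite G" "G \<subseteq> dual_space sc" "\<delta> > 0"
    "{t. \<forall>f\<in>G. norm (f t - f x) < \<delta>} \<subseteq> W" by (elim exE conjE)
  \<comment> \<open>The coordinates of the scalar functionals are real functionals. A norm is at
    most the sum of the absolute coordinates, hence the radius
    \<open>\<delta> / DIM('k)\<close>.\<close>
  define H where "H = (\<lambda>(f, b) x. f x \<bullet> b) ` (G \<times> (Basis :: 'k set))"
  define \<eta> where "\<eta> = \<delta> / DIM('k)"
  show ?thesis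
  proof (rule that[OF x])
    show "finite H" using G(1) by (simp add: H_def)
    show "\<eta> > 0" using G(3) by (simp add: \<eta>_def)
    fix h assume "h \<in> H"
    then obtain f b where fb: "f \<in> G" "h = (\<lambda>x. f x \<bullet> b)" by (auto simp: H_def)
    then have "bounded_linear f" using G(2) by (auto simp: dual_space_def)
    then show "bounded_linear h" unfolding fb(2)
      by (rule bounded_linear_compose[OF bounded_linear_inner_left])
  next
    fix t assume t: "t \<in> D" "\<forall>h\<in>H. \<bar>h t - h x\<bar> < \<eta>"
    have "norm (f t - f x) < \<delta>" if f: "f \<in> G" for f
    proof -
      have "\<bar>(f t - f x) \<bullet> b\<bar> < \<eta>" if "b \<in> Basis" for b
      proof -
        have "(\<lambda>x. f x \<bullet> b) \<in> H"
          unfolding H_def using f that by (intro image_eqI[of _ _ "(f, b)"]) auto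
        then show ?thesis using t(2) by (auto simp: inner_diff_left)
      qed
      then have "(\<Sum>b\<in>Basis. \<bar>(f t - f x) \<bullet> b\<bar>) < (\<Sum>b\<in>(Basis :: 'k set). \<eta>)"
        by (intro sum_strict_mono) auto
      also have "\<dots> = \<delta>" by (simp add: \<eta>_def)
      finally show ?thesis using norm_le_l1[of "f t - f x"] by linarith
    qed
    then have "t \<in> W" using G(4) by blast
    then have "t \<in> V" using t(1) W(2) by blast
    from V(3)[OF this] show "norm (t - x) \<le> r" by (simp add: dist_norm norm_minus_commute)
  qed
qed

end

lemma (in gap_scalars) not_cpcp: "\<not> cpcp sc C"
proof
  assume cpcp: "cpcp sc C"
  have pos: "\<epsilon> / 16 > 0" "\<epsilon> / 32 > 0" using \<epsilon>_pos by simp_all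
  obtain \<phi> :: "'a \<Rightarrow> real" and s0 where \<phi>: "\<phi> \<in> functional_ball 1" "s0 \<in> slope T" "\<phi> s0 > lam - \<epsilon> / 16"
    by (rule near_slope_functional[OF pos(1)]) (rule that)
  define D where "D = {x \<in> C. \<phi> x \<ge> lam - \<epsilon> / 8}"
  note D = weak_slab[OF \<phi>, folded D_def]
  obtain x :: 'a and G :: "('a \<Rightarrow> real) set" and \<eta> where x: "x \<in> D" "finite G" "\<And>f. f \<in> G \<Longrightarrow> bounded_linear f" "\<eta> > 0"
    "\<And>t. t \<in> D \<Longrightarrow> \<forall>f\<in>G. \<bar>f t - f x\<bar> < \<eta> \<Longrightarrow> norm (t - x) \<le> \<epsilon> / 32"
    by (rule cpcp_point[OF cpcp D(1-4) pos(2)]) (assumption | rule that)+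
  show False
    by (rule no_weak_norm_point[OF \<phi> _ _ x(2,3,4)]) (use x in \<open>auto simp: D_def\<close>)
qed

section \<open>The Daugavet equation\<close>

lemma lip_norm_eq_Sup_slope: "lip_norm T = Sup (norm ` slope T)"
proof -
  have "{norm (T x1 - T x2) / norm (x1 - x2) | x1 x2. x1 \<noteq> x2} = norm ` slope T"
    unfolding slope_def by (force simp: divide_inverse mult.commute)
  then show ?thesis unfolding lip_norm_def by simp
qed

lemma slope_add_id: "slope (\<lambda>x. x + T x) = (\<lambda>(e, s). e + s) ` slope_pairs T"
proof -
  have "slope (\<lambda>x. x + T x) =
    {(x1 - x2) /\<^sub>R norm (x1 - x2) + (T x1 - T x2) /\<^sub>R norm (x1 - x2) | x1 x2. x1 \<noteq> x2}"
    unfolding slope_def scaleR_add_right[symmetric] by (simp add: add_diff_add)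
  then show ?thesis unfolding slope_pairs_def by force
qed

lemma norm_slope_le:
  assumes "L-lipschitz_on UNIV T" and "s \<in> slope T"
  shows "norm s \<le> L"
proof -
  obtain x1 x2 where x: "x1 \<noteq> x2" "s = (T x1 - T x2) /\<^sub>R norm (x1 - x2)"
    using assms(2) unfolding slope_def by blast
  have "norm (T x1 - T x2) \<le> L * norm (x1 - x2)"
    using lipschitz_onD[OF assms(1), of x1 x2] by (simp add: dist_norm)
  then show ?thesis using x by (simp add: pos_divide_le_eq divide_inverse[symmetric] mult.commute[of "inverse _"])
qed

context scalar_structure
begin

text \<open>The upper estimate is the triangle inequality for each slope pair. If equality failed,
  the deficit would be a positive \<open>\<epsilon>\<close> as in \<open>daugavet_gap\<close>, where
  none of the four properties can hold.\<close>

theorem daugavet_equation_lipschitz: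
  fixes T :: "'a \<Rightarrow> 'a"
  assumes nonzero: "\<exists>x::'a. x \<noteq> 0" and lipschitz: "L-lipschitz_on UNIV T"
    and daugavet: "daugavet_property sc"
    and C: "C = closure (convex hull (slope T))"
    and small: "radon_nikodym_property C \<or> asplund_property sc C \<or> cpcp sc C \<or> no_l1_sequences sc C"
  shows "lip_norm (\<lambda>x. x + T x) = 1 + lip_norm T"
proof (rule ccontr)
  assume neq: "lip_norm (\<lambda>x. x + T x) \<noteq> 1 + lip_norm T"
  obtain x0 :: 'a where "x0 \<noteq> 0" using nonzero by blast
  then have pairs_ne: "slope_pairs T \<noteq> {}" using slope_pairsI[of x0 0 T] by blast
  then have ne: "slope T \<noteq> {}" by (simp add: slope_eq_image)
  have bdd: "bdd_above (norm ` slope T)"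
    using norm_slope_le[OF lipschitz] by (intro bdd_aboveI2)
  have slope_le: "norm s \<le> lip_norm T" if "s \<in> slope T" for s
    unfolding lip_norm_eq_Sup_slope using that bdd by (intro cSup_upper) auto
  have near: "\<exists>s\<in>slope T. norm s > lip_norm T - \<delta>" if "\<delta> > 0" for \<delta>
  proof -
    have "lip_norm T - \<delta> < Sup (norm ` slope T)"
      using that by (simp add: lip_norm_eq_Sup_slope)
    moreover have "norm ` slope T \<noteq> {}" using ne by simp
    ultimately show ?thesis using bdd by (simp add: less_cSup_iff)
  qed
  have sum_le: "norm (e + s) \<le> 1 + lip_norm T" if "(e, s) \<in> slope_pairs T" for e s
  proof -
    have "s \<in> slope T" using that unfolding slope_eq_image by force
    then show ?thesis
      using norm_triangle_ineq[of e s] norm_fst_slope_pairs[OF that] slope_le[of s] by linarith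
  qed
  have sums: "norm ` slope (\<lambda>x. x + T x) = (\<lambda>(e, s). norm (e + s)) ` slope_pairs T"
    by (simp add: slope_add_id image_image case_prod_unfold)
  have bdd': "bdd_above (norm ` slope (\<lambda>x. x + T x))"
    unfolding sums using sum_le by (intro bdd_aboveI2[where M = "1 + lip_norm T"]) auto
  have "lip_norm (\<lambda>x. x + T x) \<le> 1 + lip_norm T"
    unfolding lip_norm_eq_Sup_slope[of "\<lambda>x. x + T x"] sums
    using pairs_ne sum_le by (intro cSUP_least) auto
  then have lt: "lip_norm (\<lambda>x. x + T x) < 1 + lip_norm T" using neq by simp
  define \<epsilon> where "\<epsilon> = 1 + lip_norm T - lip_norm (\<lambda>x. x + T x)"
  have gap: "norm (e + s) \<le> 1 + lip_norm T - \<epsilon>" if "(e, s) \<in> slope_pairs T" for e s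
  proof -
    have "norm (e + s) \<in> norm ` slope (\<lambda>x. x + T x)" 
      unfolding sums using that by (rule rev_image_eqI) simp
    then have "norm (e + s) \<le> lip_norm (\<lambda>x. x + T x)"
      unfolding lip_norm_eq_Sup_slope using bdd' by (rule cSup_upper)
    then show ?thesis by (simp add: \<epsilon>_def)
  qed
  interpret gap: gap_scalars T "lip_norm T" \<epsilon> sc re
  proof (intro gap_scalars.intro daugavet_gap.intro lipschitz_daugavet.intro daugavet_gap_axioms.intro)
    show "continuous_on UNIV T" using lipschitz by (rule lipschitz_on_continuous_on)
    show "\<epsilon> > 0" using lt by (simp add: \<epsilon>_def)
    show "scalar_structure sc re" by (rule scalar_structure_axioms)
  qed (fact nonzero slope_le near gap | rule daugavet_direction[OF daugavet]; assumption)+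
  have "C = gap.C" by (simp add: C gap.C_def)
  then show False
    using small gap.not_radon_nikodym gap.not_cpcp gap.not_no_l1_sequences
      asplund_imp_no_l1_sequences[of C] by auto
qed

end

section \<open>The real and the complex scalar field\<close>

lemma scalar_structure_real: "scalar_structure (scaleR :: real \<Rightarrow> 'a::real_normed_vector \<Rightarrow> 'a) id"
proof
  fix g :: "'a \<Rightarrow> real" assume g: "bounded_linear g"
  then have "g \<in> dual_space scaleR"
    using linear_scale[OF bounded_linear.linear[OF g]] by (simp add: dual_space_def)
  then show "\<exists>f\<in>dual_space scaleR. \<forall>x. id (f x) = g x" by auto
qed (auto simp: scaleR_add_left scaleR_add_right linear_id)

lemma scalar_structure_complex:
  fixes sc :: "complex \<Rightarrow> 'a::real_normed_vector \<Rightarrow> 'a"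
  assumes "complex_normed_structure sc"
  shows "scalar_structure sc Re"
proof -
  interpret vs: vector_space sc using assms by (simp add: complex_normed_structure_def)
  have norm_sc: "norm (sc c x) = norm c * norm x" and sc_real: "sc (complex_of_real r) x = r *\<^sub>R x" for c r x
    using assms by (auto simp: complex_normed_structure_def)
  have "\<exists>f\<in>dual_space sc. \<forall>x. Re (f x) = g x" if g: "bounded_linear g" for g :: "'a \<Rightarrow> real"
  proof -
    have lin: "linear g" by (rule bounded_linear.linear[OF g])
    have J: "bounded_linear (sc \<i>)"
    proof (rule bounded_linear_intro[where K = 1])
      fix r x
      have "sc \<i> (sc (complex_of_real r) x) = sc (complex_of_real r) (sc \<i> x)"
        by (simp only: vs.scale_scale mult.commute)
      then show "sc \<i> (r *\<^sub>R x) = r *\<^sub>R sc \<i> x" by (simp only: sc_real)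
    qed (simp_all add: vs.scale_right_distrib norm_sc)
    \<comment> \<open>The usual complexification of a real functional: it is complex-linear with
      real part \<open>g\<close>.\<close>
    define f where "f = (\<lambda>x. complex_of_real (g x) - \<i> * complex_of_real (g (sc \<i> x)))"
    have "bounded_linear f"
      unfolding f_def
      by (intro bounded_linear_sub bounded_linear_const_mult bounded_linear_of_real[THEN bounded_linear_compose]
          g bounded_linear_compose[OF g J])
    moreover have "f (sc c x) = c * f x" for c x
    proof -
      have "sc (complex_of_real (Re c) + \<i> * complex_of_real (Im c)) x = Re c *\<^sub>R x + Im c *\<^sub>R sc \<i> x"
        unfolding vs.scale_left_distrib sc_real
        by (simp add: mult.commute[of \<i>] sc_real flip: vs.scale_scale)
      then have cx: "sc c x = Re c *\<^sub>R x + Im c *\<^sub>R sc \<i> x" by (simp flip: complex_eq)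
      have "sc \<i> (sc c x) = Re c *\<^sub>R sc \<i> x + Im c *\<^sub>R sc \<i> (sc \<i> x)"
        unfolding cx using J by (simp add: linear_add linear_scale bounded_linear.linear)
      also have "sc \<i> (sc \<i> x) = - x"
        using sc_real[of "-1" x] by (simp add: vs.scale_scale)
      finally have icx: "sc \<i> (sc c x) = Re c *\<^sub>R sc \<i> x - Im c *\<^sub>R x" by simp
      have "g (sc c x) = Re c * g x + Im c * g (sc \<i> x)"
        "g (sc \<i> (sc c x)) = Re c * g (sc \<i> x) - Im c * g x"
        unfolding icx unfolding cx
        by (simp_all add: linear_add[OF lin] linear_diff[OF lin] linear_scale[OF lin])
      then show ?thesis by (simp add: f_def complex_eq_iff)
    qed
    ultimately have "f \<in> dual_space sc" by (simp add: dual_space_def)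
    moreover have "Re (f x) = g x" for x by (simp add: f_def)
    ultimately show ?thesis by blast
  qed
  then show ?thesis
    by unfold_locales
      (simp_all add: vs.scale_left_distrib vs.scale_right_distrib vs.scale_scale norm_sc sc_real
        abs_Re_le_cmod bounded_linear.linear[OF bounded_linear_Re])
qed

text \<open>In the zero space there are no slopes and the supremum in \<open>lip_norm\<close> would
  carry no information; \<open>nonzero_space\<close> excludes this. The two conjuncts treat the two
  scalar fields for the same map and the same hull.\<close>

theorem corollary3p6:
  fixes T :: "'a::banach \<Rightarrow> 'a"
    and scC :: "complex \<Rightarrow> 'a \<Rightarrow> 'a"
    and C :: "'a set"
  assumes nonzero_space: "\<exists>x::'a. x \<noteq> 0"
    and lipschitz: "\<exists>L. L-lipschitz_on UNIV T"
    and C_eq: "C = closure (convex hull (slope T))"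
  shows
    "(daugavet_property (scaleR :: real \<Rightarrow> 'a \<Rightarrow> 'a) \<and>
        (radon_nikodym_property C \<or>
         asplund_property (scaleR :: real \<Rightarrow> 'a \<Rightarrow> 'a) C \<or>
         cpcp (scaleR :: real \<Rightarrow> 'a \<Rightarrow> 'a) C \<or>
         no_l1_sequences (scaleR :: real \<Rightarrow> 'a \<Rightarrow> 'a) C)
      \<longrightarrow> lip_norm (\<lambda>x. x + T x) = 1 + lip_norm T)
     \<and>
     (complex_normed_structure scC \<and> daugavet_property scC \<and>
        (radon_nikodym_property C \<or>
         asplund_property scC C \<or>
         cpcp scC C \<or>
         no_l1_sequences scC C)
      \<longrightarrow> lip_norm (\<lambda>x. x + T x) = 1 + lip_norm T)"
proof -
  obtain L where L: "L-lipschitz_on UNIV T" using lipschitz by blast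
  show ?thesis
    using scalar_structure.daugavet_equation_lipschitz[OF scalar_structure_real nonzero_space L _ C_eq]
      scalar_structure.daugavet_equation_lipschitz[OF scalar_structure_complex nonzero_space L _ C_eq]
    by blast
qed

end
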